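(* Let $\mu\ge0$, $\beta>0$, $N\ge1$, $\omega=|x|^{2\mu}$, and let $u$ be continuous on $\mathbb R$ with $u,u'\in L^2_\omega(\mathbb R)$. Then, with constants depending only on $\mu$, $$\bigl\|u-\widehat{I}_{2 N}^{(\mu, \beta)} u\bigr\|_{\omega} \lesssim_\mu N^{\frac{1}{2}}\bigl\|u-\widehat{\Pi}_{2 N}^{(\mu, \beta)} u\bigr\|_{\omega}+ \beta^{-1}\bigl\|\partial_x\bigl(u-\widehat{\Pi}_{2 N}^{(\mu, \beta)} u\bigr)\bigr\|_{\omega} +(\beta \sqrt{N})^{-\mu-\frac{1}{2}}\bigl|u(0)-\bigl(\widehat{\Pi}_{2 N}^{(\mu, \beta)} u\bigr)(0)\bigr|,$$ and $$\bigl\|u-\widehat{I}_{2 N+1}^{(\mu, \beta)} u\bigr\|_{\omega} \lesssim_\mu N^{\frac{1}{2}}\bigl\|u-\widehat{\Pi}_{2 N+1}^{(\mu, \beta)} u\bigr\|_{\omega}+ \beta^{-1} \bigl\|\partial_x\bigl(u-\widehat{\Pi}_{2 N+1}^{(\mu, \beta)} u\bigr)\bigr\|_{\omega}.$$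
   Context: $f\lesssim_\mu g$ means $f\le C_\mu g$ with $C_\mu$ depending only on $\mu$. $P_K$ is the space of polynomials of degree at most $K$; $\|f\|_w=(\int |f|^2w)^{1/2}$. For $\mu>-\tfrac12$, $\widehat H_n^{(\mu)}$ are the generalized Hermite functions ($e^{-x^2/2}$ times the degree-$n$ polynomials orthonormal w.r.t. $|x|^{2\mu}e^{-x^2}$). $\widehat{\Pi}_K^{(\mu,\beta)}$ is the orthogonal projection of $L^2_{|x|^{2\mu}}(\mathbb R)$ onto $\widehat P_K^{\beta,H}=\{e^{-\beta^2x^2/2}p:p\in P_K\}$. The interpolation operator $\widehat I_K^{(\mu,\beta)}$ maps a continuous $u$ to the unique element of $\widehat P_K^{\beta,H}$ agreeing with $u$ at the $K+1$ zeros of $\widehat H_{K+1}^{(\mu)}(\beta x)$. *)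

theory Defs
  imports "HOL-Analysis.Analysis" "HOL-Computational_Algebra.Polynomial"
begin

definition hweight :: "real \<Rightarrow> real \<Rightarrow> real" where
  "hweight mu x = \<bar>x\<bar> powr (2 * mu)"

definition wnorm :: "real \<Rightarrow> (real \<Rightarrow> real) \<Rightarrow> real" where
  "wnorm mu f = sqrt (LINT x|lborel. (f x)\<^sup>2 * hweight mu x)"

definition in_L2w :: "real \<Rightarrow> (real \<Rightarrow> real) \<Rightarrow> bool" where
  "in_L2w mu f \<longleftrightarrow> f \<in> borel_measurable lborel \<and>
     integrable lborel (\<lambda>x. (f x)\<^sup>2 * hweight mu x)"

text \<open>Monic generalized Hermite polynomial of degree n: monic, degree n, orthogonal
  w.r.t. |x|^(2 mu) e^(-x^2) to all polynomials of lower degree.  It has the same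
  zeros as the orthonormal one (they differ by a positive constant factor).\<close>
definition gen_hermite_monic :: "real \<Rightarrow> nat \<Rightarrow> real poly" where
  "gen_hermite_monic mu n = (THE h. degree h = n \<and> lead_coeff h = 1 \<and>
     (\<forall>q. degree q < n \<longrightarrow>
        (LINT x|lborel. poly h x * poly q x * hweight mu x * exp (- x\<^sup>2)) = 0))"

definition hspace :: "real \<Rightarrow> nat \<Rightarrow> (real \<Rightarrow> real) set" where
  "hspace beta K = {(\<lambda>x. exp (- (beta\<^sup>2 * x\<^sup>2) / 2) * poly p x) | p. degree p \<le> K}"

definition hproj :: "real \<Rightarrow> real \<Rightarrow> nat \<Rightarrow> (real \<Rightarrow> real) \<Rightarrow> (real \<Rightarrow> real)" where
  "hproj mu beta K u = (THE v. v \<in> hspace beta K \<and>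
     (\<forall>q \<in> hspace beta K. (LINT x|lborel. (u x - v x) * q x * hweight mu x) = 0))"

definition hnodes :: "real \<Rightarrow> real \<Rightarrow> nat \<Rightarrow> real set" where
  "hnodes mu beta K = {x. poly (gen_hermite_monic mu (K + 1)) (beta * x) = 0}"

definition hinterp :: "real \<Rightarrow> real \<Rightarrow> nat \<Rightarrow> (real \<Rightarrow> real) \<Rightarrow> (real \<Rightarrow> real)" where
  "hinterp mu beta K u = (THE v. v \<in> hspace beta K \<and> (\<forall>x \<in> hnodes mu beta K. v x = u x))"

end

(* Let w = u - Pi u. As the interpolation reproduces Pi u, it suffices to bound the interpolant of w, and
   after scaling beta = 1. By Gauss quadrature its squared norm is the sum over the zeros y of H_n of
   lam_y e^(y^2) w(y)^2, with the Christoffel numbers lam_y.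

   The three-term recurrence has nonnegative coefficients, so the quadrature underestimates every moment;
   hence sum_y lam_y e^(2 a |y|) is at most 2 int e^(2 a |x|) |x|^(2 mu) e^(-x^2) dx, which is
   O(e^(a^2) (1 + a)^(2 mu)). For the zeros with |y| >= 1, w(y)^2 is at most an integral of
   2 w^2 + 2 w'^2 over [|y|, |y| + 1] (with the sign of y), where e^(y^2) <= e^(1 + 2 |x y| - x^2);
   summing under the integral gives the bound.

   For 0 < |y| < 1 the same estimate on an interval of length N^(-1/2), on which the weight is at least
   |y|^(2 mu), reduces the claim to sum_y lam_y |y|^(-2 mu) = O(N^(1/2)). Hermite interpolation of t^(-m)
   in t = y^2 from below shows that sum_y lam_y y^(-2m) is at most the corresponding integral for
   m < mu + 1/2, and sum_y y^(-2) = O(N) is read off the lowest coefficients of H_n. The Christoffel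
   number of the zero y = 0 (n odd) is explicit and of order N^(-mu - 1/2). *)
theory Submission
  imports Defs "HOL-Probability.Distributions" "HOL-Real_Asymp.Real_Asymp"
begin

section \<open>Integration against the weight\<close>

text \<open>The obstacle is the product of Christoffel number and \<open>e^(y^2)\<close>, whose
  usual control rests on asymptotics of the weights and of the spacing of the zeros. Replacing
  \<open>e^(y^2)\<close> by \<open>e^(1 + 2 |x y| - x^2)\<close> turns it into an exponential moment
  whose parameter \<open>a\<close> is the integration variable \<open>|x|\<close> itself: the bound
  \<open>e^(a^2)\<close> then cancels \<open>e^(-x^2)\<close> exactly, and the number of nodes in an
  interval never has to be counted. What survives is \<open>(1 + |x|)^(2 mu)\<close>, which is
  comparable with the weight only away from the origin. This forces the separate treatment of
  \<open>|y| < 1\<close>, and the factor \<open>N^(1/2)\<close> of the claim arises only there: an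
  interval of length \<open>N^(-1/2)\<close> makes the contributions of \<open>w^2\<close> and
  \<open>w'^2\<close> stand in the ratio \<open>N : 1\<close>. Averaging over an interval pointing
  away from the origin works because the weight is there at least its value at \<open>y\<close>. At
  \<open>y = 0\<close> that value is 0 and the argument yields nothing, so \<open>|w(0)|\<close>
  stays on the right whenever 0 is a node, that is, for even degree of the space.\<close>

lemma hweight_nonneg [simp]: "hweight mu x \<ge> 0"
  by (simp add: hweight_def)

lemma hweight_minus [simp]: "hweight mu (- x) = hweight mu x"
  by (simp add: hweight_def)

lemma hweight_pos: "x \<noteq> 0 \<Longrightarrow> hweight mu x > 0"
  by (simp add: hweight_def)

lemma hweight_measurable [measurable]: "hweight mu \<in> borel_measurable borel"
  unfolding hweight_def by measurable

lemma poly_measurable [measurable]: "poly p \<in> borel_measurable (borel :: real measure)"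
  by (intro borel_measurable_continuous_onI continuous_intros)

lemma le_exp: "x \<le> exp (x::real)"
  using exp_ge_add_one_self[of x] by linarith

text \<open>Weight and polynomials alike are compared only with exponentials
  \<open>exp (d * |x|)\<close>. The Gaussian absorbs these for every \<open>d\<close>, so
  integrability needs no bookkeeping of powers.\<close>

lemma hweight_le_exp:
  assumes "mu \<ge> 0"
  shows "hweight mu x \<le> exp (2 * mu * \<bar>x\<bar>)"
proof -
  have "\<bar>x\<bar> powr (2 * mu) \<le> exp \<bar>x\<bar> powr (2 * mu)"
    using assms le_exp[of "\<bar>x\<bar>"] by (intro powr_mono2) auto
  then show ?thesis
    by (simp add: hweight_def exp_powr_real mult.commute)
qed

lemma poly_le_exp: "\<exists>C d. C \<ge> 0 \<and> d \<ge> 0 \<and> (\<forall>x::real. \<bar>poly p x\<bar> \<le> C * exp (d * \<bar>x\<bar>))"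
proof (induction p)
  case 0
  show ?case by (intro exI[of _ 0]) auto
next
  case (pCons a p)
  then obtain C d where C: "C \<ge> 0" "d \<ge> 0" "\<And>x::real. \<bar>poly p x\<bar> \<le> C * exp (d * \<bar>x\<bar>)"
    by blast
  have "\<bar>poly (pCons a p) x\<bar> \<le> (\<bar>a\<bar> + C) * exp ((d + 1) * \<bar>x\<bar>)" for x
  proof -
    have "\<bar>poly (pCons a p) x\<bar> \<le> \<bar>a\<bar> + \<bar>x\<bar> * \<bar>poly p x\<bar>"
      using abs_triangle_ineq[of a "x * poly p x"] by (simp add: abs_mult)
    also have "\<dots> \<le> \<bar>a\<bar> * exp ((d + 1) * \<bar>x\<bar>) + exp \<bar>x\<bar> * (C * exp (d * \<bar>x\<bar>))"
      using C le_exp[of "\<bar>x\<bar>"]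
      by (intro add_mono mult_mono) (auto intro!: mult_left_le simp: mult_le_cancel_left1)
    also have "\<dots> = (\<bar>a\<bar> + C) * exp ((d + 1) * \<bar>x\<bar>)"
      by (simp add: algebra_simps exp_add)
    finally show ?thesis .
  qed
  then show ?case
    using C by (intro exI[of _ "\<bar>a\<bar> + C"] exI[of _ "d + 1"]) auto
qed

text \<open>Completing the square bounds the exponent by \<open>a^2 / 2 - x^2 / 2\<close>, which
  leaves a multiple of the normal density.\<close>

lemma integrable_exp_abs_minus_square: "integrable lborel (\<lambda>x::real. exp (a * \<bar>x\<bar> - x\<^sup>2))"
proof (rule Bochner_Integration.integrable_bound)
  show "integrable lborel (\<lambda>x::real. (sqrt (2 * pi) * exp (a\<^sup>2 / 2)) * std_normal_density x)"
    by (intro integrable_mult_right) simp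
  show "AE x in lborel. norm (exp (a * \<bar>x\<bar> - x\<^sup>2))
      \<le> norm ((sqrt (2 * pi) * exp (a\<^sup>2 / 2)) * std_normal_density x)"
  proof (rule AE_I2)
    fix x :: real
    have "0 \<le> (a - \<bar>x\<bar>)\<^sup>2" by simp
    then have "a * \<bar>x\<bar> - x\<^sup>2 \<le> a\<^sup>2 / 2 + - x\<^sup>2 / 2"
      by (simp add: power2_eq_square algebra_simps)
    then have "exp (a * \<bar>x\<bar> - x\<^sup>2) \<le> exp (a\<^sup>2 / 2) * exp (- x\<^sup>2 / 2)"
      by (simp flip: exp_add)
    then show "norm (exp (a * \<bar>x\<bar> - x\<^sup>2))
      \<le> norm ((sqrt (2 * pi) * exp (a\<^sup>2 / 2)) * std_normal_density x)"
      by (simp add: std_normal_density_def abs_mult)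
  qed
qed simp

lemma integrable_hweight_gaussian:
  assumes "mu \<ge> 0" and [measurable]: "f \<in> borel_measurable borel"
    and bound: "\<And>x. \<bar>f x\<bar> \<le> C * exp (d * \<bar>x\<bar>)"
  shows "integrable lborel (\<lambda>x::real. f x * hweight mu x * exp (- x\<^sup>2))"
proof (rule Bochner_Integration.integrable_bound)
  show "integrable lborel (\<lambda>x::real. C * exp ((d + 2 * mu) * \<bar>x\<bar> - x\<^sup>2))"
    by (intro integrable_mult_right integrable_exp_abs_minus_square)
  show "AE x in lborel. norm (f x * hweight mu x * exp (- x\<^sup>2))
      \<le> norm (C * exp ((d + 2 * mu) * \<bar>x\<bar> - x\<^sup>2))"
  proof (rule AE_I2)
    fix x :: real
    have "\<bar>f x\<bar> * hweight mu x * exp (- x\<^sup>2) \<le> (C * exp (d * \<bar>x\<bar>)) * exp (2 * mu * \<bar>x\<bar>) * exp (- x\<^sup>2)"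
      using bound[of x] hweight_le_exp[OF assms(1), of x]
      by (intro mult_right_mono mult_mono) (auto intro: order_trans[OF abs_ge_zero])
    also have "\<dots> = C * exp ((d + 2 * mu) * \<bar>x\<bar> - x\<^sup>2)"
      by (simp add: algebra_simps exp_add exp_diff exp_minus divide_inverse)
    also have "\<dots> \<le> \<bar>C\<bar> * exp ((d + 2 * mu) * \<bar>x\<bar> - x\<^sup>2)"
      by (intro mult_right_mono) auto
    finally show "norm (f x * hweight mu x * exp (- x\<^sup>2))
      \<le> norm (C * exp ((d + 2 * mu) * \<bar>x\<bar> - x\<^sup>2))"
      by (simp add: abs_mult)
  qed
qed simp

lemma integrable_poly_hweight:
  assumes "mu \<ge> 0"
  shows "integrable lborel (\<lambda>x::real. poly p x * hweight mu x * exp (- x\<^sup>2))"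
proof -
  obtain C d where "\<And>x::real. \<bar>poly p x\<bar> \<le> C * exp (d * \<bar>x\<bar>)"
    using poly_le_exp by blast
  then show ?thesis
    by (intro integrable_hweight_gaussian[OF assms]) auto
qed

text \<open>A functional on polynomials rather than on functions, so that orthogonality and
  exactness of quadrature become polynomial algebra.\<close>

definition hint :: "real \<Rightarrow> real poly \<Rightarrow> real" where
  "hint mu p = (LINT x|lborel. poly p x * hweight mu x * exp (- x\<^sup>2))"

lemma hint_0 [simp]: "hint mu 0 = 0"
  by (simp add: hint_def)

lemma hint_smult [simp]: "hint mu (smult a p) = a * hint mu p"
  by (simp add: hint_def mult.assoc)

lemma hint_minus [simp]: "hint mu (- p) = - hint mu p"
  by (simp add: hint_def)

lemma hint_add:
  assumes "mu \<ge> 0"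
  shows "hint mu (p + q) = hint mu p + hint mu q"
  using integrable_poly_hweight[OF assms, of p] integrable_poly_hweight[OF assms, of q]
  by (simp add: hint_def algebra_simps)

lemma hint_diff:
  assumes "mu \<ge> 0"
  shows "hint mu (p - q) = hint mu p - hint mu q"
  using hint_add[OF assms, of p "- q"] by simp

lemma hint_sum:
  assumes "mu \<ge> 0"
  shows "hint mu (\<Sum>i\<in>A. f i) = (\<Sum>i\<in>A. hint mu (f i))"
  by (induction A rule: infinite_finite_induct) (simp_all add: hint_add[OF assms])

lemma hint_reflect: "hint mu (pcompose p [:0, -1:]) = hint mu p"
  using lborel_integral_real_affine[of "-1" "\<lambda>x. poly p x * hweight mu x * exp (- x\<^sup>2)" 0]
  by (simp add: hint_def poly_pcompose)

lemma hint_odd: "pcompose p [:0, -1:] = - p \<Longrightarrow> hint mu p = 0"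
  using hint_reflect[of mu p] by simp

text \<open>A zero integral would put almost every point into a finite set: the zeros of
  \<open>p\<close> and the origin, where the weight vanishes.\<close>

lemma hint_pos:
  assumes "mu \<ge> 0" "p \<noteq> 0" "\<And>x. poly p x \<ge> 0"
  shows "hint mu p > 0"
proof -
  let ?f = "\<lambda>x. poly p x * hweight mu x * exp (- x\<^sup>2)"
  have "hint mu p \<ge> 0"
    unfolding hint_def using assms by (intro integral_nonneg_AE) auto
  moreover have "hint mu p \<noteq> 0"
  proof
    assume "hint mu p = 0"
    then have "AE x in lborel. ?f x = 0"
      using integral_nonneg_eq_0_iff_AE[OF integrable_poly_hweight[OF assms(1), of p]] assms
      by (auto simp: hint_def)
    then have "AE x in lborel. x \<in> insert 0 {x. poly p x = 0}"
      by eventually_elim (auto simp: hweight_def)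
    moreover have "finite (insert 0 {x. poly p x = 0})"
      using poly_roots_finite[OF assms(2)] by simp
    then have "AE x in lborel. x \<notin> insert 0 {x. poly p x = 0}"
      by (intro AE_not_in finite_imp_null_set_lborel) auto
    ultimately have "AE x::real in lborel. False"
      by eventually_elim auto
    then show False
      using AE_iff_null[of lborel "\<lambda>x::real. False"] emeasure_lborel_UNIV by (auto simp: null_sets_def)
  qed
  ultimately show ?thesis by simp
qed

lemma hint_square_pos: "mu \<ge> 0 \<Longrightarrow> p \<noteq> 0 \<Longrightarrow> hint mu (p * p) > 0"
  by (rule hint_pos) auto

section \<open>Integration by parts against the weight\<close>

lemma hweight_has_real_derivative:
  assumes "x \<noteq> 0"
  shows "(hweight mu has_real_derivative 2 * mu * hweight mu x / x) (at x)"
proof (cases "x > 0")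
  case True
  have "((\<lambda>x. x powr (2 * mu)) has_real_derivative 2 * mu * x powr (2 * mu - 1)) (at x)"
    using True by (auto intro!: derivative_eq_intros)
  then have "((\<lambda>x. x powr (2 * mu)) has_real_derivative 2 * mu * hweight mu x / x) (at x)"
    using True by (simp add: hweight_def powr_diff)
  then show ?thesis
    by (rule has_field_derivative_transform_within_open[where S = "{0<..}"])
       (use True in \<open>auto simp: hweight_def\<close>)
next
  case False
  then have "x < 0" using assms by auto
  have "((\<lambda>x. (-x) powr (2 * mu)) has_real_derivative - (2 * mu * (-x) powr (2 * mu - 1))) (at x)"
    using \<open>x < 0\<close> by (auto intro!: derivative_eq_intros)
  then have "((\<lambda>x. (-x) powr (2 * mu)) has_real_derivative 2 * mu * hweight mu x / x) (at x)"
    using \<open>x < 0\<close> by (simp add: hweight_def powr_diff)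
  then show ?thesis
    by (rule has_field_derivative_transform_within_open[where S = "{..<0}"])
       (use \<open>x < 0\<close> in \<open>auto simp: hweight_def\<close>)
qed

text \<open>The factor \<open>x\<close> secures continuity at 0 also for \<open>mu = 0\<close>,
  where the convention \<open>0 powr 0 = 0\<close> makes the weight itself jump.\<close>

lemma continuous_mult_hweight:
  assumes "mu \<ge> 0"
  shows "continuous_on UNIV (\<lambda>x. x * hweight mu x)"
proof -
  have "isCont (\<lambda>x. x * hweight mu x) x" for x
  proof (cases "x = 0")
    case False
    then show ?thesis
      using DERIV_isCont[OF hweight_has_real_derivative[OF False, of mu]]
      by (intro continuous_intros)
  next
    case True
    have "((\<lambda>x. \<bar>x\<bar> * exp (2 * mu * \<bar>x\<bar>)) \<longlongrightarrow> 0) (at (0::real))"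
      by (rule tendsto_eq_intros refl | simp)+
    then have "((\<lambda>x. x * hweight mu x) \<longlongrightarrow> 0) (at 0)"
    proof (rule Lim_null_comparison[rotated])
      show "\<forall>\<^sub>F x in at 0. norm (x * hweight mu x) \<le> \<bar>x\<bar> * exp (2 * mu * \<bar>x\<bar>)"
        using hweight_le_exp[OF assms] by (intro always_eventually allI) (simp add: abs_mult mult_left_mono)
    qed
    then show ?thesis
      using True by (simp add: isCont_def)
  qed
  then show ?thesis
    by (simp add: continuous_at_imp_continuous_on)
qed

text \<open>\<open>F\<close> is an antiderivative of \<open>f\<close> that vanishes at infinity, so
  the integral of \<open>f\<close> is 0. The factor \<open>x\<close> in \<open>F\<close> cancels the
  \<open>1 / x\<close> in the derivative of the weight, so that \<open>f\<close> is again a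
  polynomial \<open>r\<close> times the Gaussian weight.\<close>

lemma hint_by_parts:
  assumes mu: "mu \<ge> 0"
  shows "hint mu ([:0, 1:] * pderiv p) = 2 * hint mu ([:0, 0, 1:] * p) - (2 * mu + 1) * hint mu p"
proof -
  define r where "r = [:0, 1:] * pderiv p + smult (2 * mu + 1) p - smult 2 ([:0, 0, 1:] * p)"
  define F where "F = (\<lambda>x. poly p x * (x * hweight mu x) * exp (- x\<^sup>2))"
  define f where "f = (\<lambda>x. poly r x * hweight mu x * exp (- x\<^sup>2))"
  have int_f: "integrable lborel f"
    unfolding f_def by (rule integrable_poly_hweight[OF mu])
  have deriv: "(F has_real_derivative f x) (at x)" if "x \<noteq> 0" for x
    unfolding F_def f_def using that
    by (auto intro!: derivative_eq_intros hweight_has_real_derivative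
        simp: r_def field_simps power2_eq_square)
  have cont: "continuous_on S F" for S
    unfolding F_def
    by (intro continuous_intros continuous_on_subset[OF continuous_mult_hweight[OF mu]]) auto
  have FTC: "(LINT x|lborel. indicator {- real n..real n} x * f x) = F (real n) - F (- real n)" for n
  proof -
    \<comment> \<open>The weight need not be differentiable at 0. One exceptional point is harmless
      because \<open>F\<close> is continuous there.\<close>
    have "(f has_integral F (real n) - F (- real n)) {- real n..real n}"
      using deriv cont
      by (intro fundamental_theorem_of_calculus_interior_strong[where S = "{0}"])
         (auto simp: has_real_derivative_iff_has_vector_derivative)
    moreover have "set_integrable lborel {- real n..real n} f"
      unfolding set_integrable_def using int_f by (intro integrable_mult_indicator) auto
    ultimately show ?thesis
      using set_borel_integral_eq_integral(2)[of "{- real n..real n}" f]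
      by (simp add: set_lebesgue_integral_def integral_unique)
  qed
  have "(\<lambda>n. LINT x|lborel. indicator {- real n..real n} x * f x) \<longlonglongrightarrow> (LINT x|lborel. f x)"
  proof (rule integral_dominated_convergence)
    show "AE x in lborel. (\<lambda>n. indicator {- real n..real n} x * f x) \<longlonglongrightarrow> f x"
    proof (intro AE_I2 tendsto_eventually)
      fix x :: real
      obtain m :: nat where "\<bar>x\<bar> \<le> real m" using real_arch_simple by blast
      then show "\<forall>\<^sub>F n in sequentially. indicator {- real n..real n} x * f x = f x"
        by (intro eventually_sequentiallyI[of m]) (auto simp: indicator_def)
    qed
    show "integrable lborel (\<lambda>x. norm (f x))"
      using int_f by (rule integrable_norm)
  qed (use int_f in \<open>auto simp: f_def indicator_def\<close>)
  moreover have "(\<lambda>n. F (real n) - F (- real n)) \<longlonglongrightarrow> 0 - 0"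
  proof -
    obtain C d where C: "C \<ge> 0" "d \<ge> 0" "\<And>x::real. \<bar>poly p x\<bar> \<le> C * exp (d * \<bar>x\<bar>)"
      using poly_le_exp by blast
    have bound: "norm (F x) \<le> C * exp ((d + 1 + 2 * mu) * \<bar>x\<bar> - x\<^sup>2)" for x
    proof -
      have "norm (F x) = \<bar>poly p x\<bar> * (\<bar>x\<bar> * hweight mu x) * exp (- x\<^sup>2)"
        by (simp add: F_def abs_mult)
      also have "\<dots> \<le> (C * exp (d * \<bar>x\<bar>)) * (exp \<bar>x\<bar> * exp (2 * mu * \<bar>x\<bar>)) * exp (- x\<^sup>2)"
        using C hweight_le_exp[OF mu, of x] le_exp[of "\<bar>x\<bar>"]
        by (intro mult_right_mono mult_mono) auto
      also have "\<dots> = C * exp ((d + 1 + 2 * mu) * \<bar>x\<bar> - x\<^sup>2)"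
        by (simp add: algebra_simps exp_add exp_diff exp_minus divide_inverse)
      finally show ?thesis .
    qed
    have lim: "(\<lambda>n. C * exp ((d + 1 + 2 * mu) * real n - (real n)\<^sup>2)) \<longlonglongrightarrow> 0"
      by real_asymp
    show ?thesis
      by (intro tendsto_diff; rule Lim_null_comparison[OF _ lim])
         (use bound[of "real _"] bound[of "- real _"] in auto)
  qed
  ultimately have "(LINT x|lborel. f x) = 0"
    using LIMSEQ_unique FTC by fastforce
  then have "hint mu r = 0"
    by (simp add: f_def hint_def)
  then show ?thesis
    unfolding r_def hint_add[OF mu] hint_diff[OF mu] hint_smult by linarith
qed

section \<open>Generalized Hermite polynomials\<close>

text \<open>The recursion fixes the sum of two neighbouring coefficients, which is the mean of
  \<open>x^2\<close> with respect to the square of the \<open>k\<close>-th orthogonal polynomial.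
  The closed form depends on the parity of the index.\<close>

fun herm_coeff :: "real \<Rightarrow> nat \<Rightarrow> real" where
  "herm_coeff mu 0 = 0"
| "herm_coeff mu (Suc k) = real k + mu + 1/2 - herm_coeff mu k"

lemma herm_coeff_even: "herm_coeff mu (2 * k) = real k"
  and herm_coeff_odd: "herm_coeff mu (Suc (2 * k)) = real k + mu + 1/2"
  by (induction k) auto

lemma herm_coeff_nonneg: "mu \<ge> 0 \<Longrightarrow> herm_coeff mu k \<ge> 0"
  by (cases k rule: parity_cases) (auto elim!: evenE oddE simp: herm_coeff_even herm_coeff_odd)

fun herm :: "real \<Rightarrow> nat \<Rightarrow> real poly" where
  "herm mu 0 = 1"
| "herm mu (Suc 0) = [:0, 1:]"
| "herm mu (Suc (Suc k)) = [:0, 1:] * herm mu (Suc k) - smult (herm_coeff mu (Suc k)) (herm mu k)"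

text \<open>Valid at \<open>k = 0\<close> as well: \<open>k - 1\<close> is then 0, but its
  coefficient vanishes.\<close>

lemma x_mult_herm:
  "[:0, 1:] * herm mu k = herm mu (Suc k) + smult (herm_coeff mu k) (herm mu (k - 1))"
  by (cases k) auto

lemma herm_monic: "degree (herm mu k) = k \<and> lead_coeff (herm mu k) = 1"
proof (induction mu k rule: herm.induct)
  case (3 mu k)
  have nz: "herm mu (Suc k) \<noteq> 0"
    using "3.IH"(1) by auto
  have deg: "degree ([:0, 1:] * herm mu (Suc k)) = Suc (Suc k)"
    using "3.IH"(1) nz by (subst degree_mult_eq) auto
  have "degree (smult (herm_coeff mu (Suc k)) (herm mu k)) < Suc (Suc k)"
    using "3.IH"(2) by (simp add: le_imp_less_Suc le_SucI)
  then have *: "degree (- smult (herm_coeff mu (Suc k)) (herm mu k)) < degree ([:0, 1:] * herm mu (Suc k))"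
    unfolding deg by simp
  have "lead_coeff ([:0, 1:] * herm mu (Suc k)) = 1"
    using "3.IH"(1) by (subst lead_coeff_mult) auto
  then show ?case
    using degree_add_eq_left[OF *] deg lead_coeff_add_le[of "- smult (herm_coeff mu (Suc k)) (herm mu k)" "[:0, 1:] * herm mu (Suc k)"] *
    by (simp del: mult_pCons_left add: coeff_eq_0)
qed auto

lemma degree_herm [simp]: "degree (herm mu k) = k"
  and lead_coeff_herm: "coeff (herm mu k) k = 1"
  using herm_monic[of mu k] by auto

lemma herm_nonzero [simp]: "herm mu k \<noteq> 0"
  using lead_coeff_herm[of mu k] by auto

lemma herm_reflect: "pcompose (herm mu k) [:0, -1:] = smult ((-1) ^ k) (herm mu k)"
  by (induction mu k rule: herm.induct)
     (auto simp: pcompose_diff pcompose_mult pcompose_smult pcompose_pCons pcompose_1 smult_diff_right mult.commute)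

lemma poly_herm_minus: "poly (herm mu k) (- x) = (-1) ^ k * poly (herm mu k) x"
  using arg_cong[OF herm_reflect, of "\<lambda>p. poly p x"] by (simp add: poly_pcompose)

lemma degree_less_decompose:
  fixes q h :: "real poly"
  assumes "degree q \<le> n" "degree h = n" "lead_coeff h = 1"
  obtains a r where "q = smult a h + r" "degree r < n \<or> r = 0"
proof
  show "q = smult (coeff q n) h + (q - smult (coeff q n) h)"
    by simp
  have "coeff (q - smult (coeff q n) h) n = 0" "degree (q - smult (coeff q n) h) \<le> n"
    using assms by (auto intro!: degree_diff_le order.trans[OF degree_smult_le])
  then show "degree (q - smult (coeff q n) h) < n \<or> q - smult (coeff q n) h = 0"
    by (metis le_neq_implies_less leading_coeff_0_iff)
qed

lemma x_pderiv_monic: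
  fixes h :: "real poly"
  assumes "degree h = n" "lead_coeff h = 1"
  shows "[:0, 1:] * pderiv h = smult (real n) h \<or>
     degree ([:0, 1:] * pderiv h - smult (real n) h) < n"
proof -
  let ?r = "[:0, 1:] * pderiv h - smult (real n) h"
  have *: "coeff ?r i = (real i - real n) * coeff h i" for i
    by (cases i) (auto simp: coeff_pderiv algebra_simps)
  have "coeff ?r i = 0" if "i \<ge> n" for i
    unfolding * using that assms by (cases "i = n") (auto simp: coeff_eq_0)
  then show ?thesis
    by (metis (mono_tags, lifting) eq_iff_diff_eq_0 leading_coeff_0_iff not_le)
qed

text \<open>The recursion for the coefficients is what integrating \<open>x p'\<close> by parts for \<open>p = (herm mu k)\<^sup>2\<close>
  says about the norms of the polynomials, so that norms and orthogonality are obtained in one induction.\<close>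

lemma herm_orthogonal_aux:
  assumes mu: "mu \<ge> 0"
  shows "(\<forall>q. degree q < k \<longrightarrow> hint mu (herm mu k * q) = 0) \<and>
    hint mu (herm mu (Suc k) * herm mu (Suc k)) = herm_coeff mu (Suc k) * hint mu (herm mu k * herm mu k)"
proof (induction k rule: less_induct)
  case (less k)
  note [simp del] = herm.simps mult_pCons_left mult_pCons_right herm_coeff.simps
  have lower: "hint mu (herm mu k * q) = 0" if q: "degree q < k" for q
  proof (cases k)
    case 0
    then show ?thesis using q by simp
  next
    case (Suc j)
    have Hk: "herm mu k = [:0, 1:] * herm mu j - smult (herm_coeff mu j) (herm mu (j - 1))"
      using x_mult_herm[of mu j] Suc by simp
    have j: "hint mu (herm mu j * r) = 0" if "degree r < j" for r
      using less.IH[of j] Suc that by auto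
    have j1: "hint mu (herm mu (j - 1) * r) = 0" if "degree r < j - 1" for r
      using less.IH[of "j - 1"] Suc that by auto
    \<comment> \<open>Against the immediate predecessor parity decides: \<open>x\<close> times the
      square of \<open>herm mu j\<close> is odd.\<close>
    have Hj: "hint mu (herm mu k * herm mu j) = 0"
    proof -
      have "hint mu ([:0, 1:] * herm mu j * herm mu j) = 0"
        by (rule hint_odd)
           (simp add: pcompose_mult herm_reflect pcompose_pCons mult_pCons_left mult_pCons_right flip: power_mult_distrib)
      moreover have "herm_coeff mu j * hint mu (herm mu (j - 1) * herm mu j) = 0"
        using j[of "herm mu (j - 1)"] by (cases j) (auto simp: mult.commute herm_coeff.simps)
      ultimately show ?thesis
        by (simp add: Hk algebra_simps hint_diff[OF mu])
    qed
    \<comment> \<open>Moving the factor \<open>x\<close> onto \<open>r\<close> leaves only the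
      component along \<open>herm mu i\<close> with \<open>i = j - 1\<close>. There the two terms of
      the recurrence cancel by the ratio of norms from the induction hypothesis.\<close>
    have Hlow: "hint mu (herm mu k * r) = 0" if r: "degree r < j" for r
    proof -
      obtain i where i: "j = Suc i" using r by (cases j) auto
      have "hint mu (herm mu k * s) = 0" if s: "degree s < i \<or> s = 0" for s
      proof -
        have "degree ([:0, 1:] * s) < j" if "s \<noteq> 0"
          using s that i by (subst degree_mult_eq) auto
        then have "hint mu (herm mu j * ([:0, 1:] * s)) = 0"
          using j by (cases "s = 0") auto
        moreover have "hint mu (herm mu i * s) = 0"
          using j1[of s] s i by auto
        ultimately show ?thesis
          using i by (simp add: Hk algebra_simps hint_diff[OF mu])
      qed
      moreover have "hint mu (herm mu k * herm mu i) = 0"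
      proof -
        obtain s where s: "[:0, 1:] * herm mu i = herm mu j + s" "degree s < j \<or> s = 0"
        proof
          show "[:0, 1:] * herm mu i = herm mu j + smult (herm_coeff mu i) (herm mu (i - 1))"
            using x_mult_herm[of mu i] i by simp
          show "degree (smult (herm_coeff mu i) (herm mu (i - 1))) < j \<or> smult (herm_coeff mu i) (herm mu (i - 1)) = 0"
            using i by (cases i) (auto simp: le_less_trans[OF degree_smult_le])
        qed
        have "hint mu (herm mu j * ([:0, 1:] * herm mu i)) = hint mu (herm mu j * herm mu j)"
          unfolding s using j[of s] s(2) by (auto simp: algebra_simps hint_add[OF mu])
        also have "\<dots> = herm_coeff mu j * hint mu (herm mu i * herm mu i)"
          using less.IH[of i] Suc i by simp
        finally show ?thesis
          using i by (simp add: Hk algebra_simps hint_diff[OF mu])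
      qed
      moreover obtain a s where "r = smult a (herm mu i) + s" "degree s < i \<or> s = 0"
        by (rule degree_less_decompose[of r i "herm mu i"]) (use r i lead_coeff_herm in auto)
      ultimately show ?thesis
        by (simp add: algebra_simps hint_add[OF mu])
    qed
    obtain a s where "q = smult a (herm mu j) + s" "degree s < j \<or> s = 0"
      by (rule degree_less_decompose[of q j "herm mu j"]) (use q Suc lead_coeff_herm in auto)
    then show ?thesis
      using Hj Hlow[of s] by (auto simp: algebra_simps hint_add[OF mu])
  qed
  let ?H = "herm mu k" and ?h = "\<lambda>k. hint mu (herm mu k * herm mu k)"
  \<comment> \<open>Since \<open>x H'\<close> is \<open>k H\<close> up to lower degree, integration
    by parts for \<open>H^2\<close> evaluates the integral of \<open>x^2 H^2\<close> (fact 1).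
    Expanding the square of \<open>x H - c G\<close>, with \<open>c = herm_coeff mu k\<close> and
    \<open>G\<close> the predecessor of \<open>H\<close>, then gives the next norm.\<close>
  have "[:0, 1:] * pderiv (?H * ?H) = ?H * ([:0, 1:] * pderiv ?H) + ?H * ([:0, 1:] * pderiv ?H)"
    by (simp only: pderiv_mult distrib_left mult_ac)
  then have "hint mu ([:0, 1:] * pderiv (?H * ?H)) = 2 * hint mu (?H * ([:0, 1:] * pderiv ?H))"
    by (simp only: hint_add[OF mu] mult_2)
  also have "hint mu (?H * ([:0, 1:] * pderiv ?H)) = real k * ?h k"
  proof -
    define r where "r = [:0, 1:] * pderiv ?H - smult (real k) ?H"
    have "r = 0 \<or> degree r < k"
      using x_pderiv_monic[of ?H k] lead_coeff_herm by (auto simp: r_def)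
    then have "hint mu (?H * r) = 0"
      using lower by auto
    then show ?thesis
      by (simp add: r_def algebra_simps hint_diff[OF mu])
  qed
  finally have 1: "hint mu ([:0, 0, 1:] * (?H * ?H)) = (real k + (mu + 1/2)) * ?h k"
    using hint_by_parts[OF mu, of "?H * ?H"] by (simp add: algebra_simps)
  \<comment> \<open>Both identities carry the factor \<open>herm_coeff mu k\<close> because at
    \<open>k = 0\<close> the index \<open>k - 1\<close> is a default value. The factor is 0
    there.\<close>
  have 2: "herm_coeff mu k * hint mu (([:0, 1:] * ?H) * herm mu (k - 1)) = herm_coeff mu k * ?h k"
    and 3: "herm_coeff mu k * (herm_coeff mu k * ?h (k - 1)) = herm_coeff mu k * ?h k"
  proof -
    have "hint mu (([:0, 1:] * ?H) * herm mu (k - 1)) = ?h k" if "k = Suc j" for j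
    proof -
      have "([:0, 1:] * ?H) * herm mu (k - 1) = ?H * ([:0, 1:] * herm mu j)"
        using that by (simp add: algebra_simps)
      also have "\<dots> = ?H * ?H + smult (herm_coeff mu j) (?H * herm mu (j - 1))"
        unfolding x_mult_herm using that by (simp add: algebra_simps)
      finally show ?thesis
        using lower[of "herm mu (j - 1)"] that by (simp add: hint_add[OF mu])
    qed
    then show "herm_coeff mu k * hint mu (([:0, 1:] * ?H) * herm mu (k - 1)) = herm_coeff mu k * ?h k"
      by (cases k) (auto simp: herm_coeff.simps)
    show "herm_coeff mu k * (herm_coeff mu k * ?h (k - 1)) = herm_coeff mu k * ?h k"
      using less.IH[of "k - 1"] by (cases k) (auto simp: herm_coeff.simps)
  qed
  have Hk: "herm mu (Suc k) = [:0, 1:] * ?H - smult (herm_coeff mu k) (herm mu (k - 1))"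
    using x_mult_herm[of mu k] by simp
  have "herm mu (Suc k) * herm mu (Suc k) = [:0, 0, 1:] * (?H * ?H)
      - smult 2 (smult (herm_coeff mu k) (([:0, 1:] * ?H) * herm mu (k - 1)))
      + smult (herm_coeff mu k) (smult (herm_coeff mu k) (herm mu (k - 1) * herm mu (k - 1)))"
    unfolding Hk by (rule poly_eq_poly_eq_iff[THEN iffD1], rule ext) (simp add: algebra_simps)
  then have "?h (Suc k) = hint mu ([:0, 0, 1:] * (?H * ?H))
      - 2 * (herm_coeff mu k * hint mu (([:0, 1:] * ?H) * herm mu (k - 1)))
      + herm_coeff mu k * (herm_coeff mu k * ?h (k - 1))"
    by (simp add: hint_diff[OF mu] hint_add[OF mu])
  also have "\<dots> = herm_coeff mu (Suc k) * ?h k"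
    unfolding 1 2 3 by (simp add: herm_coeff.simps algebra_simps)
  finally show ?case
    using lower by blast
qed

lemma herm_orthogonal:
  "mu \<ge> 0 \<Longrightarrow> degree q < k \<Longrightarrow> hint mu (herm mu k * q) = 0"
  using herm_orthogonal_aux by blast

lemma hint_herm:
  assumes "mu \<ge> 0"
  shows "hint mu (herm mu k) = (if k = 0 then hint mu 1 else 0)"
  using herm_orthogonal[OF assms, of 1 k] by auto

lemma monic_orthogonal_unique:
  assumes mu: "mu \<ge> 0"
    and h: "degree h = n" "lead_coeff h = 1" "\<And>q. degree q < n \<Longrightarrow> hint mu (h * q) = 0"
  shows "h = herm mu n"
proof (rule ccontr)
  assume "h \<noteq> herm mu n"
  define d where "d = h - herm mu n"
  have "d \<noteq> 0" using \<open>h \<noteq> herm mu n\<close> by (simp add: d_def)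
  moreover have "coeff d n = 0" "degree d \<le> n"
    using h lead_coeff_herm[of mu n] by (auto simp: d_def intro!: degree_diff_le)
  ultimately have deg: "degree d < n"
    by (metis le_neq_implies_less leading_coeff_0_iff)
  have "d * d = h * d - herm mu n * d"
    by (simp add: d_def algebra_simps)
  then have "hint mu (d * d) = hint mu (h * d) - hint mu (herm mu n * d)"
    by (simp add: hint_diff[OF mu])
  then have "hint mu (d * d) = 0"
    using h(3)[OF deg] herm_orthogonal[OF mu deg] by simp
  then show False
    using hint_square_pos[OF mu \<open>d \<noteq> 0\<close>] by simp
qed

text \<open>Passes from the characterization by orthogonality to the recurrence, whose nonnegative
  coefficients and explicit lowest terms carry the later estimates.\<close>

lemma gen_hermite_monic_eq_herm:
  assumes mu: "mu \<ge> 0"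
  shows "gen_hermite_monic mu n = herm mu n"
  unfolding gen_hermite_monic_def
proof (rule the_equality)
  have eq: "(LINT x|lborel. poly h x * poly q x * hweight mu x * exp (- x\<^sup>2)) = hint mu (h * q)" for h q
    by (simp add: hint_def)
  show "degree (herm mu n) = n \<and> lead_coeff (herm mu n) = 1 \<and> (\<forall>q. degree q < n \<longrightarrow>
     (LINT x|lborel. poly (herm mu n) x * poly q x * hweight mu x * exp (- x\<^sup>2)) = 0)"
    unfolding eq using herm_monic herm_orthogonal[OF mu] by blast
  show "h = herm mu n" if "degree h = n \<and> lead_coeff h = 1 \<and> (\<forall>q. degree q < n \<longrightarrow>
     (LINT x|lborel. poly h x * poly q x * hweight mu x * exp (- x\<^sup>2)) = 0)" for h
    using that unfolding eq by (intro monic_orthogonal_unique[OF mu]) auto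
qed

section \<open>Zeros of the Hermite polynomials\<close>

lemma dvd_prod_linear:
  fixes p :: "real poly"
  assumes "finite S" "\<And>z. z \<in> S \<Longrightarrow> poly p z = 0"
  shows "(\<Prod>z\<in>S. [:- z, 1:]) dvd p"
  using assms
proof (induction S rule: finite_induct)
  case (insert z S)
  then obtain g where g: "p = (\<Prod>z\<in>S. [:- z, 1:]) * g"
    by (auto elim: dvdE)
  have "poly (\<Prod>z\<in>S. [:- z, 1:]) z \<noteq> 0"
    using insert.hyps by (auto simp: poly_prod)
  then have "poly g z = 0"
    using insert.prems[of z] by (simp add: g)
  then obtain k where "g = [:- z, 1:] * k"
    by (auto simp: poly_eq_0_iff_dvd elim: dvdE)
  then have "p = (\<Prod>z\<in>insert z S. [:- z, 1:]) * k"
    using insert.hyps by (simp add: g mult_ac del: mult_pCons_left mult_pCons_right)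
  then show ?case ..
qed auto

lemma poly_no_root_sign:
  fixes g :: "real poly"
  assumes "\<And>x. poly g x \<noteq> 0"
  shows "(\<forall>x. poly g x > 0) \<or> (\<forall>x. poly g x < 0)"
proof (rule ccontr)
  assume "\<not> ?thesis"
  then obtain a b where ab: "poly g a < 0" "poly g b > 0"
    using assms by (meson linorder_neqE_linordered_idom)
  then have "a \<noteq> b" by auto
  then show False
    using poly_IVT_pos[of a b g] poly_IVT_neg[of b a g] ab assms by (meson linorder_neqE_linordered_idom)
qed

definition herm_roots :: "real \<Rightarrow> nat \<Rightarrow> real set" where
  "herm_roots mu n = {x. poly (herm mu n) x = 0}"

lemma finite_herm_roots [simp]: "finite (herm_roots mu n)"
  unfolding herm_roots_def by (rule poly_roots_finite) simp

lemma herm_roots_minus: "- x \<in> herm_roots mu n \<longleftrightarrow> x \<in> herm_roots mu n"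
  by (simp add: herm_roots_def poly_herm_minus)

text \<open>Let \<open>g\<close> be the cofactor of the product \<open>P\<close> over the distinct
  real zeros. A zero \<open>z\<close> of \<open>g\<close> would be a double zero,
  \<open>H = (x - z)^2 q\<close>, and then \<open>H q\<close> is a square with integral 0. So
  \<open>g\<close> has constant sign; were it not constant, \<open>H P = P^2 g\<close> would have
  integral 0 by orthogonality but a definite sign.\<close>

lemma herm_eq_prod:
  assumes mu: "mu \<ge> 0"
  shows "herm mu n = (\<Prod>z\<in>herm_roots mu n. [:- z, 1:])"
proof -
  let ?Z = "herm_roots mu n" and ?P = "\<Prod>z\<in>herm_roots mu n. [:- z, 1:]"
  obtain g where g: "herm mu n = ?P * g"
  proof -
    have "?P dvd herm mu n"
      by (rule dvd_prod_linear) (simp, simp add: herm_roots_def)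
    then show ?thesis
      using that by (rule dvdE)
  qed
  have [simp]: "?P \<noteq> 0" "g \<noteq> 0"
    using g herm_nonzero[of mu n] by (metis mult_zero_left, metis mult_zero_right)
  have "poly g z \<noteq> 0" for z
  proof
    assume gz: "poly g z = 0"
    then have "poly (?P * g) z = 0"
      by simp
    then have "poly (herm mu n) z = 0"
      by (subst g)
    then have z: "z \<in> ?Z"
      by (simp add: herm_roots_def)
    obtain k where k: "g = [:- z, 1:] * k"
      using gz by (auto simp: poly_eq_0_iff_dvd elim: dvdE)
    define q where "q = (\<Prod>z\<in>?Z - {z}. [:- z, 1:]) * k"
    have H: "herm mu n = [:- z, 1:] * [:- z, 1:] * q"
    proof -
      have "?P = [:- z, 1:] * (\<Prod>z\<in>?Z - {z}. [:- z, 1:])"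
        using z by (subst prod.remove[of _ z]) auto
      then show ?thesis
        unfolding g k q_def by (simp only: mult_ac)
    qed
    have q: "q \<noteq> 0"
      using H herm_nonzero[of mu n] by auto
    have "degree (herm mu n) = degree [:- z, 1:] + degree [:- z, 1:] + degree q"
      unfolding H using q by (subst degree_mult_eq) (auto simp del: mult_pCons_left mult_pCons_right simp: degree_mult_eq)
    then have h0: "hint mu (herm mu n * q) = 0"
      by (intro herm_orthogonal[OF mu]) simp
    have eq: "herm mu n * q = ([:- z, 1:] * q) * ([:- z, 1:] * q)"
      by (simp only: H mult_ac)
    have "[:- z, 1:] * q \<noteq> 0"
      using q by (metis mult_eq_0_iff pCons_eq_0_iff zero_neq_one)
    from hint_square_pos[OF mu this] show False
      unfolding eq[symmetric] h0 by simp
  qed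
  then have sgn: "(\<forall>x. poly g x > 0) \<or> (\<forall>x. poly g x < 0)"
    by (rule poly_no_root_sign)
  have "degree (?P * g) = degree ?P + degree g"
    by (rule degree_mult_eq) simp_all
  then have deg: "n = degree ?P + degree g"
    unfolding g[symmetric] degree_herm .
  have "degree g = 0"
  proof (rule ccontr)
    assume "degree g \<noteq> 0"
    then have "hint mu (herm mu n * ?P) = 0"
      using deg by (intro herm_orthogonal[OF mu]) simp
    moreover have "herm mu n * ?P = ?P * ?P * g"
      by (simp only: g mult_ac)
    ultimately have *: "hint mu (?P * ?P * g) = 0" by simp
    have nz: "?P * ?P * g \<noteq> 0" "?P * ?P * - g \<noteq> 0" by simp_all
    from sgn show False
    proof
      assume pos: "\<forall>x. poly g x > 0"
      have "hint mu (?P * ?P * g) > 0"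
        using pos by (intro hint_pos[OF mu nz(1)]) (simp only: poly_mult zero_le_square mult_nonneg_nonneg less_imp_le)
      with * show False by simp
    next
      assume neg: "\<forall>x. poly g x < 0"
      have "hint mu (?P * ?P * - g) > 0"
        using neg by (intro hint_pos[OF mu nz(2)])
          (simp only: poly_mult poly_minus zero_le_square mult_nonneg_nonneg neg_0_le_iff_le less_imp_le)
      with * show False by simp
    qed
  qed
  then obtain a where a: "g = [:a:]"
    by (auto elim: degree_eq_zeroE)
  have "lead_coeff ?P = 1"
    by (simp add: lead_coeff_prod)
  then have "lead_coeff (?P * g) = a"
    by (subst lead_coeff_mult) (simp add: a)
  then have "a = 1"
    unfolding g[symmetric] using herm_monic[of mu n] by simp
  then show ?thesis
    using g a by simp
qed

lemma card_herm_roots: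
  assumes "mu \<ge> 0"
  shows "card (herm_roots mu n) = n"
proof -
  have "degree (\<Prod>z\<in>herm_roots mu n. [:- z, 1::real:]) = card (herm_roots mu n)"
    by (subst degree_prod_eq_sum_degree) auto
  then show ?thesis
    using arg_cong[OF herm_eq_prod[OF assms, of n], of degree] by simp
qed

section \<open>Gauss quadrature and its moments\<close>

definition lagrange :: "real \<Rightarrow> nat \<Rightarrow> real \<Rightarrow> real poly" where
  "lagrange mu n y = smult (1 / (\<Prod>z\<in>herm_roots mu n - {y}. y - z)) (\<Prod>z\<in>herm_roots mu n - {y}. [:- z, 1:])"

lemma poly_lagrange:
  assumes "y \<in> herm_roots mu n" "z \<in> herm_roots mu n"
  shows "poly (lagrange mu n y) z = (if z = y then 1 else 0)"
  using assms by (auto simp: lagrange_def poly_prod)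

lemma degree_lagrange:
  assumes "mu \<ge> 0" "y \<in> herm_roots mu n"
  shows "degree (lagrange mu n y) < n"
proof -
  have "degree (\<Prod>z\<in>herm_roots mu n - {y}. [:- z, 1::real:]) = card (herm_roots mu n - {y})"
    by (subst degree_prod_eq_sum_degree) auto
  also have "\<dots> < n"
    using psubset_card_mono[of "herm_roots mu n" "herm_roots mu n - {y}"] assms
    by (auto simp: card_herm_roots)
  finally show ?thesis
    unfolding lagrange_def by (rule le_less_trans[OF degree_smult_le])
qed

definition interp :: "real \<Rightarrow> nat \<Rightarrow> (real \<Rightarrow> real) \<Rightarrow> real poly" where
  "interp mu n f = (\<Sum>y\<in>herm_roots mu n. smult (f y) (lagrange mu n y))"

lemma poly_interp: "z \<in> herm_roots mu n \<Longrightarrow> poly (interp mu n f) z = f z"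
  by (simp add: interp_def poly_sum poly_lagrange if_distrib cong: if_cong)

lemma degree_interp:
  assumes "mu \<ge> 0" "n \<ge> 1"
  shows "degree (interp mu n f) \<le> n - 1"
proof -
  have "degree (smult (f y) (lagrange mu n y)) \<le> n - 1" if "y \<in> herm_roots mu n" for y
    using degree_lagrange[OF assms(1) that] degree_smult_le[of "f y" "lagrange mu n y"] by linarith
  then show ?thesis
    unfolding interp_def by (intro degree_sum_le) auto
qed

lemma poly_eqI_herm_roots:
  assumes "mu \<ge> 0" "n \<ge> 1" "degree p \<le> n - 1" "degree q \<le> n - 1"
    and "\<And>y. y \<in> herm_roots mu n \<Longrightarrow> poly p y = poly q y"
  shows "p = q"
proof (rule ccontr)
  assume "p \<noteq> q"
  then have nz: "p - q \<noteq> 0" by simp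
  have "n = card (herm_roots mu n)"
    using card_herm_roots[OF assms(1)] by simp
  also have "\<dots> \<le> card {x. poly (p - q) x = 0}"
    using nz assms(5) by (intro card_mono poly_roots_finite) auto
  also have "\<dots> \<le> degree (p - q)"
    using nz by (intro card_poly_roots_bound)
  also have "\<dots> \<le> n - 1"
    using assms by (intro degree_diff_le)
  finally show False using assms(2) by simp
qed

definition gauss_weight :: "real \<Rightarrow> nat \<Rightarrow> real \<Rightarrow> real" where
  "gauss_weight mu n y = hint mu (lagrange mu n y)"

definition quad :: "real \<Rightarrow> nat \<Rightarrow> real poly \<Rightarrow> real" where
  "quad mu n p = (\<Sum>y\<in>herm_roots mu n. gauss_weight mu n y * poly p y)"

text \<open>After division by \<open>herm mu n\<close> the remainder is its own interpolant, and the
  quotient has degree below \<open>n\<close>, so orthogonality removes it.\<close>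

lemma quad_exact:
  assumes mu: "mu \<ge> 0" and n: "n \<ge> 1" and deg: "degree p \<le> 2 * n - 1"
  shows "quad mu n p = hint mu p"
proof -
  let ?H = "herm mu n"
  have lt: "degree (p mod ?H) \<le> n - 1"
    using degree_mod_less[of ?H p] n by auto
  have "p mod ?H = interp mu n (poly p)"
  proof (rule poly_eqI_herm_roots[OF mu n lt degree_interp[OF mu n]])
    fix y assume y: "y \<in> herm_roots mu n"
    have "poly p y = poly (p div ?H * ?H + p mod ?H) y"
      by (simp only: div_mult_mod_eq)
    also have "\<dots> = poly (p mod ?H) y"
      unfolding poly_add poly_mult using y by (simp add: herm_roots_def)
    finally show "poly (p mod ?H) y = poly (interp mu n (poly p)) y"
      using y by (simp add: poly_interp)
  qed
  then have quad: "hint mu (p mod ?H) = quad mu n p"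
    by (simp add: interp_def hint_sum[OF mu] quad_def gauss_weight_def mult.commute)
  have "hint mu (?H * (p div ?H)) = 0"
  proof (rule herm_orthogonal[OF mu])
    show "degree (p div ?H) < n"
    proof (cases "p div ?H = 0")
      case False
      have "degree (?H * (p div ?H)) = degree (p - p mod ?H)"
        by (simp add: minus_mod_eq_mult_div)
      also have "\<dots> \<le> 2 * n - 1"
        using deg lt by (intro degree_diff_le) simp_all
      finally show ?thesis
        using False n by (simp add: degree_mult_eq)
    qed (use n in simp)
  qed
  then have "hint mu (?H * (p div ?H) + p mod ?H) = hint mu (p mod ?H)"
    by (simp only: hint_add[OF mu] add_0)
  then show ?thesis
    by (simp add: quad)
qed

text \<open>The square of a Lagrange polynomial has degree at most \<open>2 n - 2\<close>, so the
  quadrature is exact for it and returns just this weight.\<close>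

lemma gauss_weight_pos:
  assumes mu: "mu \<ge> 0" and n: "n \<ge> 1" and y: "y \<in> herm_roots mu n"
  shows "gauss_weight mu n y > 0"
proof -
  let ?l = "lagrange mu n y"
  have "degree (?l * ?l) \<le> 2 * n - 1"
    using degree_lagrange[OF mu y] by (intro order.trans[OF degree_mult_le]) simp
  then have "hint mu (?l * ?l) = quad mu n (?l * ?l)"
    using quad_exact[OF mu n] by simp
  also have "\<dots> = (\<Sum>z\<in>herm_roots mu n. if z = y then gauss_weight mu n z else 0)"
    unfolding quad_def by (rule sum.cong) (auto simp: poly_lagrange[OF y])
  also have "\<dots> = gauss_weight mu n y"
    using y by simp
  moreover have "?l \<noteq> 0"
    using poly_lagrange[OF y y] by auto
  ultimately show ?thesis
    using hint_square_pos[OF mu] by metis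
qed

section \<open>Comparison of moments and exponential moments\<close>

lemma quad_add: "quad mu n (p + q) = quad mu n p + quad mu n q"
  by (simp add: quad_def algebra_simps sum.distrib)

lemma quad_smult: "quad mu n (smult a p) = a * quad mu n p"
  by (simp add: quad_def algebra_simps sum_distrib_left)

lemma quad_sum: "quad mu n (\<Sum>i\<in>A. f i) = (\<Sum>i\<in>A. quad mu n (f i))"
  by (induction A rule: infinite_finite_induct) (simp_all add: quad_add quad_smult[of mu n 0 0, simplified])

text \<open>Both functionals satisfy the three-term recurrence in \<open>(m, k)\<close>, but \<^const>\<open>quad\<close> vanishes at
  \<open>k = n\<close>: the truncation only loses nonnegative terms.\<close>

lemma quad_power_herm_le:
  assumes mu: "mu \<ge> 0" and n: "n \<ge> 1"
  shows "hint mu (monom 1 m * herm mu k) \<ge> 0 \<and>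
    (k \<le> n \<longrightarrow> quad mu n (monom 1 m * herm mu k) \<le> hint mu (monom 1 m * herm mu k))"
proof (induction m arbitrary: k)
  case 0
  have "hint mu 1 > 0"
    using hint_square_pos[OF mu, of 1] by simp
  moreover have "quad mu n (herm mu k) = hint mu (herm mu k)" if "k \<le> n"
    using that n by (intro quad_exact[OF mu n]) simp
  ultimately show ?case
    using hint_herm[OF mu, of k] by (auto simp: monom_0 simp flip: one_pCons)
next
  case (Suc m)
  have eq: "monom 1 (Suc m) * herm mu k =
      monom 1 m * herm mu (Suc k) + smult (herm_coeff mu k) (monom 1 m * herm mu (k - 1))"
  proof -
    have "monom 1 (Suc m) * herm mu k = monom 1 m * ([:0, 1:] * herm mu k)"
      by (simp add: monom_Suc)
    then show ?thesis
      unfolding x_mult_herm by (simp add: algebra_simps)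
  qed
  have nonneg: "hint mu (monom 1 (Suc m) * herm mu k) \<ge> 0"
    unfolding eq hint_add[OF mu] hint_smult using Suc.IH herm_coeff_nonneg[OF mu] by simp
  have "quad mu n (monom 1 (Suc m) * herm mu k) \<le> hint mu (monom 1 (Suc m) * herm mu k)" if "k \<le> n"
  proof (cases "k = n")
    case True
    then have "quad mu n (monom 1 (Suc m) * herm mu k) = 0"
      by (simp add: quad_def herm_roots_def)
    then show ?thesis using nonneg by simp
  next
    case False
    then show ?thesis
      unfolding eq hint_add[OF mu] hint_smult quad_add quad_smult
      using Suc.IH herm_coeff_nonneg[OF mu] that by (intro add_mono mult_left_mono) auto
  qed
  with nonneg show ?case by blast
qed

lemma quad_monom_le:
  assumes "mu \<ge> 0" "n \<ge> 1"
  shows "quad mu n (monom 1 m) \<le> hint mu (monom 1 m)"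
  using quad_power_herm_le[OF assms, of m 0] by simp

text \<open>\<open>cosh\<close> replaces \<open>exp (2 a |y|)\<close> because it is a power series
  with nonnegative coefficients, to which the comparison of moments applies term by term. Its
  partial sums are bounded under the integral before the limit is taken, so only the finite sum over
  the nodes has to converge.\<close>

lemma quad_cosh_le:
  assumes mu: "mu \<ge> 0" and n: "n \<ge> 1" and a: "a \<ge> 0"
  shows "(\<Sum>y\<in>herm_roots mu n. gauss_weight mu n y * cosh (2 * a * y))
    \<le> (LINT x|lborel. exp (2 * a * \<bar>x\<bar>) * hweight mu x * exp (- x\<^sup>2))"
proof -
  let ?c = "\<lambda>i. if even i then (2 * a) ^ i / fact i else 0"
  define T where "T = (\<lambda>M. \<Sum>i<M. smult (?c i) (monom 1 i))"
  have poly_T: "poly (T M) x = (\<Sum>i<M. if even i then (2 * a * x) ^ i /\<^sub>R fact i else 0)" for M x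
    unfolding T_def poly_sum
    by (intro sum.cong) (auto simp: poly_monom power_mult_distrib field_simps)
  have lim: "(\<lambda>M. poly (T M) x) \<longlonglongrightarrow> cosh (2 * a * x)" for x
    using cosh_converges[of "2 * a * x"] unfolding poly_T sums_def .
  have T_le: "poly (T M) x \<le> exp (2 * a * \<bar>x\<bar>)" for M x
  proof -
    have "poly (T M) x \<le> cosh (2 * a * x)"
      unfolding poly_T sums_unique[OF cosh_converges]
      by (intro sum_le_suminf sums_summable[OF cosh_converges]) (auto simp: zero_le_even_power)
    also have "\<dots> \<le> exp (2 * a * \<bar>x\<bar>)"
      using a by (auto simp: cosh_def field_simps abs_if mult_nonneg_nonpos)
    finally show ?thesis .
  qed
  have "quad mu n (T M) \<le> (LINT x|lborel. exp (2 * a * \<bar>x\<bar>) * hweight mu x * exp (- x\<^sup>2))" for M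
  proof -
    have "quad mu n (T M) \<le> hint mu (T M)"
      unfolding T_def quad_sum quad_smult hint_sum[OF mu] hint_smult
      using quad_monom_le[OF mu n] by (intro sum_mono mult_left_mono) (use a in auto)
    also have "\<dots> \<le> (LINT x|lborel. exp (2 * a * \<bar>x\<bar>) * hweight mu x * exp (- x\<^sup>2))"
      unfolding hint_def
    proof (intro integral_mono integrable_poly_hweight[OF mu] mult_right_mono T_le)
      show "integrable lborel (\<lambda>x::real. exp (2 * a * \<bar>x\<bar>) * hweight mu x * exp (- x\<^sup>2))"
        by (rule integrable_hweight_gaussian[OF mu, where C = 1 and d = "2 * a"]) auto
    qed auto
    finally show ?thesis .
  qed
  moreover have "(\<lambda>M. quad mu n (T M)) \<longlonglongrightarrow> (\<Sum>y\<in>herm_roots mu n. gauss_weight mu n y * cosh (2 * a * y))"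
    unfolding quad_def by (intro tendsto_sum tendsto_mult tendsto_const lim)
  ultimately show ?thesis
    by (intro LIMSEQ_le_const2) auto
qed

text \<open>With \<open>z = |x| - a\<close> the exponent is
  \<open>2 a |x| - x^2 = a^2 - z^2\<close>, and \<open>|x| \<le> (1 + a) (1 + |z|)\<close> splits
  the weight into a power of \<open>1 + a\<close> and a factor that the Gaussian in \<open>z\<close>
  absorbs.\<close>

lemma gaussian_shift_le:
  assumes mu: "mu \<ge> 0"
  obtains C where "C > 0" "\<And>a. a \<ge> 0 \<Longrightarrow>
    (LINT x|lborel. exp (2 * a * \<bar>x\<bar>) * hweight mu x * exp (- x\<^sup>2)) \<le> C * exp (a\<^sup>2) * (1 + a) powr (2 * mu)"
proof
  let ?g = "\<lambda>z. exp (2 * mu * \<bar>z\<bar> - z\<^sup>2) :: real"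
  define C where "C = 2 * (LINT z|lborel. ?g z) + 1"
  have "(LINT z|lborel. ?g z) \<ge> 0"
    by simp
  then show "C > 0"
    unfolding C_def by linarith
  fix a :: real assume a: "a \<ge> 0"
  have int: "integrable lborel (\<lambda>x. ?g (t + 1 * x))" for t
    by (intro lborel_integrable_real_affine integrable_exp_abs_minus_square) simp
  have eq: "(LINT x|lborel. ?g (t + 1 * x)) = (LINT x|lborel. ?g x)" for t
    by (subst lborel_integral_real_affine[of 1 ?g t]) auto
  have le: "exp (2 * a * \<bar>x\<bar>) * hweight mu x * exp (- x\<^sup>2)
      \<le> exp (a\<^sup>2) * (1 + a) powr (2 * mu) * (?g (- a + 1 * x) + ?g (a + 1 * x))" for x
  proof -
    define z where "z = \<bar>x\<bar> - a"
    have "\<bar>x\<bar> \<le> a + \<bar>z\<bar>"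
      by (simp add: z_def)
    also have "\<dots> \<le> (1 + a) * (1 + \<bar>z\<bar>)"
      using a by (simp add: algebra_simps)
    also have "\<dots> \<le> (1 + a) * exp \<bar>z\<bar>"
      using a by (intro mult_left_mono) auto
    finally have "hweight mu x \<le> ((1 + a) * exp \<bar>z\<bar>) powr (2 * mu)"
      unfolding hweight_def using mu by (intro powr_mono2) auto
    also have "\<dots> = (1 + a) powr (2 * mu) * exp (2 * mu * \<bar>z\<bar>)"
      using a by (simp add: powr_mult exp_powr_real mult.commute)
    finally have "exp (2 * a * \<bar>x\<bar>) * hweight mu x * exp (- x\<^sup>2)
        \<le> exp (2 * a * \<bar>x\<bar>) * ((1 + a) powr (2 * mu) * exp (2 * mu * \<bar>z\<bar>)) * exp (- x\<^sup>2)"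
      by (intro mult_right_mono mult_left_mono) auto
    also have "\<dots> = (1 + a) powr (2 * mu) * exp (2 * a * \<bar>x\<bar> + 2 * mu * \<bar>z\<bar> - x\<^sup>2)"
      by (simp add: exp_add exp_diff exp_minus field_simps)
    also have "2 * a * \<bar>x\<bar> + 2 * mu * \<bar>z\<bar> - x\<^sup>2 = a\<^sup>2 + (2 * mu * \<bar>z\<bar> - z\<^sup>2)"
      by (simp add: z_def power2_eq_square algebra_simps)
    also have "(1 + a) powr (2 * mu) * exp (a\<^sup>2 + (2 * mu * \<bar>z\<bar> - z\<^sup>2)) = exp (a\<^sup>2) * (1 + a) powr (2 * mu) * ?g z"
      by (simp only: exp_add mult_ac)
    \<comment> \<open>\<open>z\<close> is \<open>x - a\<close> or \<open>-(x + a)\<close> according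
      to the sign of \<open>x\<close>, and \<open>?g\<close> is even. The sum of both translates
      avoids splitting the integral.\<close>
    also have "?g z \<le> ?g (- a + 1 * x) + ?g (a + 1 * x)"
    proof (cases "x \<ge> 0")
      case True
      then have "z = - a + 1 * x" by (simp add: z_def)
      then show ?thesis by simp
    next
      case False
      then have "\<bar>z\<bar> = \<bar>a + 1 * x\<bar>" "z\<^sup>2 = (a + 1 * x)\<^sup>2"
        by (auto simp: z_def power2_eq_square algebra_simps)
      then show ?thesis by simp
    qed
    finally show ?thesis
      by (simp add: mult_left_mono)
  qed
  have "(LINT x|lborel. exp (2 * a * \<bar>x\<bar>) * hweight mu x * exp (- x\<^sup>2))
      \<le> (LINT x|lborel. exp (a\<^sup>2) * (1 + a) powr (2 * mu) * (?g (- a + 1 * x) + ?g (a + 1 * x)))"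
  proof (rule integral_mono)
    show "integrable lborel (\<lambda>x::real. exp (2 * a * \<bar>x\<bar>) * hweight mu x * exp (- x\<^sup>2))"
      by (rule integrable_hweight_gaussian[OF mu, where C = 1 and d = "2 * a"]) auto
    show "integrable lborel (\<lambda>x. exp (a\<^sup>2) * (1 + a) powr (2 * mu) * (?g (- a + 1 * x) + ?g (a + 1 * x)))"
      by (intro integrable_mult_right Bochner_Integration.integrable_add int)
  qed (rule le)
  also have "\<dots> = exp (a\<^sup>2) * (1 + a) powr (2 * mu) * (2 * (LINT x|lborel. ?g x))"
    by (subst integral_mult_right_zero, subst Bochner_Integration.integral_add[OF int int], subst (1 2) eq) simp
  also have "\<dots> \<le> exp (a\<^sup>2) * (1 + a) powr (2 * mu) * C"
    by (intro mult_left_mono) (auto simp: C_def)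
  finally show "(LINT x|lborel. exp (2 * a * \<bar>x\<bar>) * hweight mu x * exp (- x\<^sup>2)) \<le> C * exp (a\<^sup>2) * (1 + a) powr (2 * mu)"
    by (simp only: mult_ac)
qed

lemma quad_exp_le:
  assumes mu: "mu \<ge> 0"
  obtains C where "C > 0" "\<And>n a. n \<ge> 1 \<Longrightarrow> a \<ge> 0 \<Longrightarrow>
    (\<Sum>y\<in>herm_roots mu n. gauss_weight mu n y * exp (2 * a * \<bar>y\<bar>)) \<le> C * exp (a\<^sup>2) * (1 + a) powr (2 * mu)"
proof -
  obtain C where C: "C > 0" "\<And>a. a \<ge> 0 \<Longrightarrow>
    (LINT x|lborel. exp (2 * a * \<bar>x\<bar>) * hweight mu x * exp (- x\<^sup>2)) \<le> C * exp (a\<^sup>2) * (1 + a) powr (2 * mu)"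
    using gaussian_shift_le[OF mu] by blast
  show thesis
  proof (rule that[of "2 * C"])
    fix n :: nat and a :: real assume n: "n \<ge> 1" and a: "a \<ge> 0"
    have "exp (2 * a * \<bar>y\<bar>) \<le> 2 * cosh (2 * a * y)" for y
      by (cases "y \<ge> 0") (auto simp: cosh_def)
    then have "(\<Sum>y\<in>herm_roots mu n. gauss_weight mu n y * exp (2 * a * \<bar>y\<bar>))
        \<le> (\<Sum>y\<in>herm_roots mu n. gauss_weight mu n y * (2 * cosh (2 * a * y)))"
      using gauss_weight_pos[OF mu n] by (intro sum_mono mult_left_mono) (auto intro: less_imp_le)
    also have "\<dots> = 2 * (\<Sum>y\<in>herm_roots mu n. gauss_weight mu n y * cosh (2 * a * y))"
      by (simp add: sum_distrib_left mult_ac)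
    also have "\<dots> \<le> 2 * (C * exp (a\<^sup>2) * (1 + a) powr (2 * mu))"
      using quad_cosh_le[OF mu n a] C(2)[OF a] by simp
    finally show "(\<Sum>y\<in>herm_roots mu n. gauss_weight mu n y * exp (2 * a * \<bar>y\<bar>))
        \<le> 2 * C * exp (a\<^sup>2) * (1 + a) powr (2 * mu)"
      by (simp only: mult.assoc)
  qed (use C in auto)
qed

section \<open>The node at the origin and the smallest nodes\<close>

text \<open>The quotient of \<open>herm mu (2 k + 1)\<close> by \<open>x\<close>, given its own
  recursion so that its coefficients and its integral can be computed by induction.\<close>

fun herm_odd :: "real \<Rightarrow> nat \<Rightarrow> real poly" where
  "herm_odd mu 0 = 1"
| "herm_odd mu (Suc k) = herm mu (2 * k + 2) - smult (real k + 1) (herm_odd mu k)"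

lemma herm_odd_eq: "herm mu (Suc (2 * k)) = [:0, 1:] * herm_odd mu k"
proof (induction k)
  case (Suc k)
  have "herm mu (Suc (2 * Suc k)) = [:0, 1:] * herm mu (2 * k + 2) -
      smult (herm_coeff mu (2 * (k + 1))) (herm mu (Suc (2 * k)))"
    by (simp del: herm_coeff.simps)
  then show ?case
    unfolding Suc.IH herm_coeff_even by (simp add: smult_diff_right algebra_simps)
qed auto

lemma herm_even_Suc:
  "herm mu (2 * k + 2) = [:0, 1:] * ([:0, 1:] * herm_odd mu k) - smult (real k + mu + 1/2) (herm mu (2 * k))"
  unfolding herm_odd_eq[symmetric] herm_coeff_odd[symmetric] by simp

lemma pochhammer_shift: "pochhammer (c::real) (Suc k) = c * pochhammer (c + 1) k"
  by (rule pochhammer_rec)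

text \<open>The value at 0 enters the Christoffel number of the origin; the ratio of the
  coefficients of \<open>x^2\<close> and 1 gives the sum of \<open>1 / z^2\<close> over the zeros.
  Even and odd degrees feed each other, hence the joint induction.\<close>

lemma herm_low_coeffs:
  assumes mu: "mu \<ge> 0"
  defines "c \<equiv> mu + 1/2"
  shows "coeff (herm mu (2 * k)) 0 = (-1) ^ k * pochhammer c k"
    and "coeff (herm mu (2 * k)) 1 = 0"
    and "coeff (herm mu (2 * k)) 2 = - ((-1) ^ k * pochhammer c k * (k / c))"
    and "coeff (herm_odd mu k) 0 = (-1) ^ k * pochhammer (c + 1) k"
    and "coeff (herm_odd mu k) 1 = 0"
    and "coeff (herm_odd mu k) 2 = - ((-1) ^ k * pochhammer (c + 1) k * (k / (c + 1)))"
proof -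
  have c: "c > 0" using mu by (simp add: c_def)
  have "coeff (herm mu (2 * k)) 0 = (-1) ^ k * pochhammer c k \<and>
    coeff (herm mu (2 * k)) 1 = 0 \<and>
    coeff (herm mu (2 * k)) 2 = - ((-1) ^ k * pochhammer c k * (k / c)) \<and>
    coeff (herm_odd mu k) 0 = (-1) ^ k * pochhammer (c + 1) k \<and>
    coeff (herm_odd mu k) 1 = 0 \<and>
    coeff (herm_odd mu k) 2 = - ((-1) ^ k * pochhammer (c + 1) k * (k / (c + 1)))"
  proof (induction k)
    case 0
    show ?case by (simp add: numeral_2_eq_2)
  next
    case (Suc k)
    let ?e = "(-1) ^ k * pochhammer (c + 1) k"
    have p: "pochhammer c k * (c + k) = c * pochhammer (c + 1) k"
      using pochhammer_shift[of c k] pochhammer_Suc[of c k] by simp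
    have p1: "pochhammer (c + 1) (Suc k) = pochhammer (c + 1) k * (c + 1 + k)"
      by (simp add: pochhammer_Suc)
    have H: "herm mu (2 * Suc k) = [:0, 1:] * ([:0, 1:] * herm_odd mu k) - smult (k + c) (herm mu (2 * k))"
      using herm_even_Suc[of mu k] by (simp add: c_def add.assoc)
    have A: "coeff (herm mu (2 * Suc k)) 0 = - (c * ?e)" "coeff (herm mu (2 * Suc k)) 1 = 0"
      "coeff (herm mu (2 * Suc k)) 2 = ?e * (Suc k)"
    proof -
      have "coeff (herm mu (2 * Suc k)) 0 = - ((k + c) * ((-1) ^ k * pochhammer c k))"
        unfolding H using Suc.IH by simp
      also have "\<dots> = - ((-1) ^ k * (pochhammer c k * (c + k)))"
        by (simp add: algebra_simps)
      finally show "coeff (herm mu (2 * Suc k)) 0 = - (c * ?e)"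
        unfolding p by simp
      show "coeff (herm mu (2 * Suc k)) 1 = 0"
        unfolding H using Suc.IH by simp
      have "coeff (herm mu (2 * Suc k)) 2 = ?e + (k + c) * ((-1) ^ k * pochhammer c k * (k / c))"
        unfolding H using Suc.IH by (simp add: numeral_2_eq_2)
      also have "\<dots> = ?e + (-1) ^ k * (pochhammer c k * (c + k)) * (k / c)"
        using c by (simp add: field_simps)
      also have "\<dots> = ?e * (Suc k)"
        unfolding p using c by (simp add: field_simps)
      finally show "coeff (herm mu (2 * Suc k)) 2 = ?e * (Suc k)" .
    qed
    have E: "herm_odd mu (Suc k) = herm mu (2 * Suc k) - smult (real k + 1) (herm_odd mu k)"
      by simp
    have B: "coeff (herm_odd mu (Suc k)) 0 = - ?e * (c + 1 + k)" "coeff (herm_odd mu (Suc k)) 1 = 0"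
      "coeff (herm_odd mu (Suc k)) 2 = ?e * Suc k * (c + 1 + k) / (c + 1)"
      unfolding E coeff_diff coeff_smult A using Suc.IH c by (simp_all add: field_simps)
    have "c * pochhammer (c + 1) k = pochhammer c (Suc k)"
      by (simp add: pochhammer_shift)
    then have "coeff (herm mu (2 * Suc k)) 0 = (-1) ^ Suc k * pochhammer c (Suc k)"
      "coeff (herm mu (2 * Suc k)) 2 = - ((-1) ^ Suc k * pochhammer c (Suc k) * (Suc k / c))"
      unfolding A pochhammer_shift using c by (simp_all add: field_simps)
    then show ?case
      unfolding A(2) B p1 using c by (simp add: field_simps)
  qed
  then show "coeff (herm mu (2 * k)) 0 = (-1) ^ k * pochhammer c k"
    and "coeff (herm mu (2 * k)) 1 = 0"
    and "coeff (herm mu (2 * k)) 2 = - ((-1) ^ k * pochhammer c k * (k / c))"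
    and "coeff (herm_odd mu k) 0 = (-1) ^ k * pochhammer (c + 1) k"
    and "coeff (herm_odd mu k) 1 = 0"
    and "coeff (herm_odd mu k) 2 = - ((-1) ^ k * pochhammer (c + 1) k * (k / (c + 1)))"
    by blast+
qed

lemma zero_in_herm_roots_odd: "0 \<in> herm_roots mu (Suc (2 * k))"
  by (simp add: herm_roots_def herm_odd_eq)

lemma zero_notin_herm_roots_even:
  assumes "mu \<ge> 0"
  shows "0 \<notin> herm_roots mu (2 * k)"
  using herm_low_coeffs(1)[OF assms, of k] pochhammer_pos[of "mu + 1/2" k] assms
  by (simp add: herm_roots_def poly_0_coeff_0)

lemma hint_herm_odd:
  assumes mu: "mu \<ge> 0"
  shows "hint mu (herm_odd mu k) = (-1) ^ k * fact k * hint mu 1"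
  by (induction k) (simp_all add: hint_diff[OF mu] hint_herm[OF mu] algebra_simps del: herm.simps)

text \<open>\<open>herm_odd mu k\<close> vanishes at every node except 0, so exact quadrature gives
  the weight as its integral divided by its value at 0. The signs \<open>(-1)^k\<close>
  cancel.\<close>

lemma gauss_weight_0:
  assumes mu: "mu \<ge> 0"
  shows "gauss_weight mu (Suc (2 * k)) 0 = hint mu 1 * (fact k / pochhammer (mu + 3/2) k)"
proof -
  let ?n = "Suc (2 * k)" and ?E = "herm_odd mu k"
  have "?E \<noteq> 0"
    using herm_odd_eq[of mu k] herm_nonzero[of mu ?n] by fastforce
  then have "degree ?E = 2 * k"
    using arg_cong[OF herm_odd_eq[of mu k], of degree] by simp
  then have "quad mu ?n ?E = hint mu ?E"
    by (intro quad_exact[OF mu]) auto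
  moreover have "quad mu ?n ?E = (\<Sum>y\<in>herm_roots mu ?n. if y = 0 then gauss_weight mu ?n 0 * poly ?E 0 else 0)"
    unfolding quad_def
  proof (rule sum.cong)
    fix y assume "y \<in> herm_roots mu ?n"
    then have "y * poly ?E y = 0"
      by (simp only: herm_roots_def herm_odd_eq) simp
    then show "gauss_weight mu ?n y * poly ?E y = (if y = 0 then gauss_weight mu ?n 0 * poly ?E 0 else 0)"
      by auto
  qed simp
  ultimately have "gauss_weight mu ?n 0 * poly ?E 0 = hint mu ?E"
    using zero_in_herm_roots_odd by simp
  moreover have "poly ?E 0 = (-1) ^ k * pochhammer (mu + 3/2) k"
    using herm_low_coeffs(4)[OF mu, of k] by (simp add: poly_0_coeff_0 add.assoc)
  moreover have "pochhammer (mu + 3/2) k > 0"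
    using mu by (intro pochhammer_pos) simp
  ultimately show ?thesis
    unfolding hint_herm_odd[OF mu] by (simp add: field_simps)
qed

text \<open>Up to the factor \<open>c k^(-c)\<close> with \<open>c = mu + 1/2\<close>, the quotient
  of factorial and Pochhammer symbol is a term of the sequence converging to \<open>Gamma c\<close>,
  hence bounded.\<close>

lemma gauss_weight_0_le:
  assumes mu: "mu \<ge> 0"
  obtains C where "C > 0" "\<And>k. k \<ge> 1 \<Longrightarrow> gauss_weight mu (Suc (2 * k)) 0 \<le> C * real k powr (- mu - 1/2)"
proof -
  define c where "c = mu + 1/2"
  have c: "c > 0" using mu by (simp add: c_def)
  have "Bseq (Gamma_series c)"
    using Gamma_series_LIMSEQ by (intro convergent_imp_Bseq) (auto simp: convergent_def)
  then obtain B where B: "B > 0" "\<And>k. \<bar>Gamma_series c k\<bar> \<le> B"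
    unfolding Bseq_def by auto
  have h1: "hint mu 1 > 0"
    using hint_square_pos[OF mu, of 1] by simp
  show thesis
  proof (rule that[of "hint mu 1 * (c * B)"])
    show "hint mu 1 * (c * B) > 0"
      using h1 c B by simp
    fix k :: nat assume k: "k \<ge> 1"
    have pos: "pochhammer (c + 1) k > 0"
      using c by (intro pochhammer_pos) simp
    have "Gamma_series c k = fact k * real k powr c / (c * pochhammer (c + 1) k)"
      using k by (simp add: Gamma_series_def pochhammer_shift powr_def)
    then have "fact k / pochhammer (c + 1) k = c * Gamma_series c k * real k powr (- c)"
      using c k pos by (simp add: field_simps powr_minus)
    also have "\<dots> \<le> c * B * real k powr (- c)"
      using B(2)[of k] c by (intro mult_right_mono mult_left_mono) auto
    finally have "hint mu 1 * (fact k / pochhammer (c + 1) k) \<le> hint mu 1 * (c * B * real k powr (- c))"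
      using h1 by (intro mult_left_mono) auto
    moreover have "c + 1 = mu + 3/2" "- c = - mu - 1/2"
      by (simp_all add: c_def)
    ultimately show "gauss_weight mu (Suc (2 * k)) 0 \<le> hint mu 1 * (c * B) * real k powr (- mu - 1/2)"
      unfolding gauss_weight_0[OF mu] by (simp only: mult.assoc)
  qed
qed

section \<open>Distance of the nonzero zeros from the origin\<close>

lemma coeff_prod_quadratic:
  fixes r :: "'a \<Rightarrow> real"
  assumes "finite S"
  shows "coeff (\<Prod>i\<in>S. [:1, 0, - r i:]) 0 = 1 \<and> coeff (\<Prod>i\<in>S. [:1, 0, - r i:]) 1 = 0 \<and>
    coeff (\<Prod>i\<in>S. [:1, 0, - r i:]) 2 = - (\<Sum>i\<in>S. r i)"
  using assms by (induction S rule: finite_induct) (auto simp: numeral_2_eq_2)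

text \<open>By symmetry of the zeros the product over all of them counts each \<open>z^2\<close>
  twice, once for each sign. No positive half has to be selected, and as a polynomial in
  \<open>x^2\<close> it has the double zeros that Hermite interpolation needs.\<close>

lemma prod_herm_roots_square:
  "(\<Prod>z\<in>herm_roots mu n - {0}. x - z) ^ 2 = (\<Prod>z\<in>herm_roots mu n - {0}. x\<^sup>2 - z\<^sup>2)"
proof -
  have "(\<Prod>z\<in>herm_roots mu n - {0}. x - z) = (\<Prod>z\<in>herm_roots mu n - {0}. x + z)"
    by (rule prod.reindex_bij_witness[of _ uminus uminus]) (auto simp: herm_roots_minus)
  then have "(\<Prod>z\<in>herm_roots mu n - {0}. x - z) ^ 2
      = (\<Prod>z\<in>herm_roots mu n - {0}. x - z) * (\<Prod>z\<in>herm_roots mu n - {0}. x + z)"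
    by (simp add: power2_eq_square)
  also have "\<dots> = (\<Prod>z\<in>herm_roots mu n - {0}. x\<^sup>2 - z\<^sup>2)"
    unfolding prod.distrib[symmetric] by (rule prod.cong) (auto simp: power2_eq_square algebra_simps)
  finally show ?thesis .
qed

text \<open>Up to a constant factor this is a square, and the sign of the constant is read off at
  \<open>x = 0\<close>, where the product is 1.\<close>

lemma prod_herm_roots_nonneg:
  "(\<Prod>z\<in>herm_roots mu n - {0}. 1 - x\<^sup>2 / z\<^sup>2) \<ge> 0"
proof -
  have "(\<Prod>z\<in>herm_roots mu n - {0}. 1 - x\<^sup>2 / z\<^sup>2)
      = (\<Prod>z\<in>herm_roots mu n - {0}. x\<^sup>2 - z\<^sup>2) * (\<Prod>z\<in>herm_roots mu n - {0}. - 1 / z\<^sup>2)"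
    unfolding prod.distrib[symmetric] by (rule prod.cong) (auto simp: field_simps)
  moreover have "(\<Prod>z\<in>herm_roots mu n - {0}. 0\<^sup>2 - z\<^sup>2) \<ge> 0"
    unfolding prod_herm_roots_square[symmetric] by simp
  moreover have "(\<Prod>z\<in>herm_roots mu n - {0}. 0\<^sup>2 - z\<^sup>2) * (\<Prod>z\<in>herm_roots mu n - {0}. - 1 / z\<^sup>2) = 1"
    unfolding prod.distrib[symmetric] by (rule prod.neutral) auto
  ultimately show ?thesis
    unfolding prod_herm_roots_square[symmetric]
    by (metis mult_nonneg_nonneg zero_le_mult_iff zero_le_power2 linear zero_less_one not_le mult_le_0_iff)
qed

text \<open>\<open>G\<close> is the product of \<open>x - z\<close> over the nonzero zeros, so its
  square is a multiple of the product of \<open>1 - x^2 / z^2\<close>. Comparing the coefficients of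
  1 and \<open>x^2\<close> evaluates the sum of all \<open>1 / z^2\<close>, and one term is at most
  the sum.\<close>

lemma herm_root_lower_bound:
  assumes mu: "mu \<ge> 0" and y: "y \<in> herm_roots mu n" "y \<noteq> 0"
  shows "1 / y\<^sup>2 \<le> 4 * real (n div 2)"
proof -
  define Z where "Z = herm_roots mu n - {0}"
  define P where "P = (\<Prod>z\<in>Z. [:1, 0, - (1 / z\<^sup>2):])"
  define G where "G = (if even n then herm mu n else herm_odd mu (n div 2))"
  define c1 where "c1 = (\<Prod>z\<in>Z. - (z\<^sup>2))"
  define g where "g = (if even n then mu + 1/2 else mu + 1/2 + 1)"
  have finZ: "finite Z" by (simp add: Z_def)
  have poly_G: "poly G x = (\<Prod>z\<in>Z. x - z)" for x
  proof (cases "even n")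
    case True
    then have "0 \<notin> herm_roots mu n"
      using zero_notin_herm_roots_even[OF mu, of "n div 2"] by simp
    then show ?thesis
      using True arg_cong[OF herm_eq_prod[OF mu, of n], of "\<lambda>p. poly p x"] by (simp add: G_def Z_def poly_prod)
  next
    case False
    then have n: "n = Suc (2 * (n div 2))" by simp
    then have Z0: "0 \<in> herm_roots mu n"
      using zero_in_herm_roots_odd[of mu "n div 2"] by simp
    have "[:0, 1:] * herm_odd mu (n div 2) = herm mu n"
      using herm_odd_eq[of mu "n div 2"] n by metis
    also have "\<dots> = [:0, 1:] * (\<Prod>z\<in>Z. [:- z, 1:])"
      unfolding Z_def by (subst herm_eq_prod[OF mu], subst prod.remove[OF _ Z0]) simp_all
    finally have "herm_odd mu (n div 2) = (\<Prod>z\<in>Z. [:- z, 1:])"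
      by (metis mult_left_cancel pCons_eq_0_iff zero_neq_one)
    then show ?thesis
      using False by (simp add: G_def poly_prod)
  qed
  have "G * G = smult c1 P"
  proof (rule poly_eq_poly_eq_iff[THEN iffD1], rule ext)
    fix x
    have "poly (G * G) x = (\<Prod>z\<in>Z. x\<^sup>2 - z\<^sup>2)"
      using prod_herm_roots_square[of x mu n] by (simp add: poly_G Z_def power2_eq_square)
    also have "\<dots> = poly (smult c1 P) x"
      unfolding c1_def P_def poly_smult poly_prod prod.distrib[symmetric] Z_def
      by (rule prod.cong) (auto simp: field_simps power2_eq_square)
    finally show "poly (G * G) x = poly (smult c1 P) x" .
  qed
  then have eqs: "coeff (G * G) 0 = c1" "coeff (G * G) 2 = - c1 * (\<Sum>z\<in>Z. 1 / z\<^sup>2)"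
    using coeff_prod_quadratic[OF finZ, of "\<lambda>z. 1 / z\<^sup>2"] by (auto simp: P_def)
  have G: "coeff G 0 \<noteq> 0" "coeff G 1 = 0" "coeff G 2 = - (coeff G 0 * (real (n div 2) / g))"
  proof -
    have "pochhammer (mu + 1/2) k > 0" "pochhammer (mu + 1/2 + 1) k > 0" for k
      using mu by (auto intro!: pochhammer_pos)
    note pos = this[of "n div 2", THEN less_imp_neq]
    show "coeff G 0 \<noteq> 0" "coeff G 1 = 0" "coeff G 2 = - (coeff G 0 * (real (n div 2) / g))"
      using herm_low_coeffs[OF mu, of "n div 2"] pos by (auto simp: G_def g_def)
  qed
  have "coeff (G * G) 0 = coeff G 0 * coeff G 0" "coeff (G * G) 2 = 2 * coeff G 0 * coeff G 2"
    using G(2) by (auto simp: coeff_mult numeral_2_eq_2)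
  then have "(coeff G 0 * coeff G 0) * (\<Sum>z\<in>Z. 1 / z\<^sup>2) = (coeff G 0 * coeff G 0) * (2 * (real (n div 2) / g))"
    using eqs G(3) by simp
  then have "(\<Sum>z\<in>Z. 1 / z\<^sup>2) = 2 * (real (n div 2) / g)"
    using G(1) by (simp only: mult_cancel_left) simp
  moreover have "1 / y\<^sup>2 \<le> (\<Sum>z\<in>Z. 1 / z\<^sup>2)"
    using y finZ by (intro member_le_sum) (auto simp: Z_def)
  \<comment> \<open>The bound \<open>g \<ge> 1/2\<close> removes \<open>mu\<close> from the estimate
    and turns the factor 2 into 4.\<close>
  moreover have "real (n div 2) / g \<le> real (n div 2) / (1/2)"
    using mu by (intro divide_left_mono) (auto simp: g_def)
  ultimately show ?thesis by simp
qed

section \<open>Negative moments of the quadrature\<close>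

lemma inverse_prod_linear_nonneg:
  fixes r :: "'a \<Rightarrow> real"
  assumes "finite S" "\<And>i. i \<in> S \<Longrightarrow> r i \<ge> 0"
  obtains f where "fps_of_poly (\<Prod>i\<in>S. [:1, - r i:]) * f = 1" "\<And>k. fps_nth f k \<ge> 0"
proof -
  have "\<exists>f. fps_of_poly (\<Prod>i\<in>S. [:1, - r i:]) * f = 1 \<and> (\<forall>k. fps_nth f k \<ge> 0)"
    using assms
  proof (induction S rule: finite_induct)
    case empty
    show ?case by (intro exI[of _ 1]) (auto simp: fps_one_nth)
  next
    case (insert i S)
    then obtain f where f: "fps_of_poly (\<Prod>i\<in>S. [:1, - r i:]) * f = 1" "\<And>k. fps_nth f k \<ge> 0"
      by auto
    \<comment> \<open>The geometric series inverts a single factor; nonnegative coefficients survive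
      multiplication.\<close>
    define g where "g = Abs_fps (\<lambda>k. r i ^ k)"
    have g: "fps_of_poly [:1, - r i:] * g = 1"
    proof (rule fps_ext)
      fix k
      show "fps_nth (fps_of_poly [:1, - r i:] * g) k = fps_nth 1 k"
        by (cases k) (auto simp: g_def fps_of_poly_pCons algebra_simps)
    qed
    have "fps_of_poly (\<Prod>i\<in>insert i S. [:1, - r i:]) * (g * f)
        = (fps_of_poly [:1, - r i:] * g) * (fps_of_poly (\<Prod>i\<in>S. [:1, - r i:]) * f)"
      using insert.hyps by (simp only: prod.insert fps_of_poly_mult mult_ac not_False_eq_True if_False)
    then have "fps_of_poly (\<Prod>i\<in>insert i S. [:1, - r i:]) * (g * f) = 1"
      unfolding f g by simp
    moreover have "fps_nth (g * f) k \<ge> 0" for k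
      using insert.prems f by (auto simp: fps_mult_nth g_def intro!: sum_nonneg)
    ultimately show ?case by blast
  qed
  then show thesis using that by blast
qed

text \<open>Hermite interpolation of \<open>t \<mapsto> t\<^sup>-\<^sup>m\<close> at the zeros of \<open>\<rho>\<close>: with \<open>A\<close> the Taylor polynomial of
  \<open>1 / \<rho>\<close> of degree less than \<open>m\<close>, whose coefficients are nonnegative, \<open>P = (1 - \<rho> A) / t\<^sup>m\<close>.\<close>

lemma inverse_power_interpolation:
  fixes r :: "'a \<Rightarrow> real"
  assumes S: "finite S" "\<And>i. i \<in> S \<Longrightarrow> r i \<ge> 0"
  defines "\<rho> \<equiv> (\<Prod>i\<in>S. [:1, - r i:])"
  obtains P A where "degree P \<le> card S - 1" "poly P 0 \<ge> 0" "\<And>t. t \<ge> 0 \<Longrightarrow> poly A t \<ge> 0"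
    "1 - \<rho> * A = monom 1 m * P"
proof (cases m)
  case 0
  then show ?thesis
    by (intro that[of 1 0]) (auto simp: monom_0 simp flip: one_pCons)
next
  case (Suc l)
  obtain f where f: "fps_of_poly \<rho> * f = 1" "\<And>k. fps_nth f k \<ge> 0"
    using inverse_prod_linear_nonneg[OF S(1), of r] S(2) unfolding \<rho>_def by blast
  define A where "A = (\<Sum>i<m. monom (fps_nth f i) i)"
  have coeff_A: "coeff A i = (if i < m then fps_nth f i else 0)" for i
    by (simp add: A_def coeff_sum)
  have "coeff \<rho> 0 = 1"
    unfolding \<rho>_def by (simp flip: poly_0_coeff_0 add: poly_prod)
  \<comment> \<open>The series \<open>f - A\<close> starts in degree \<open>m\<close>, and so does
    its product with \<open>\<rho>\<close>. This gives both the divisibility by \<open>t^m\<close>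
    and the constant term of \<open>P\<close>, the nonnegative coefficient of \<open>f\<close> in
    degree \<open>m\<close>.\<close>
  have eq: "fps_of_poly (1 - \<rho> * A) = fps_of_poly \<rho> * (f - fps_of_poly A)"
    using f(1) by (simp add: fps_of_poly_diff fps_of_poly_mult algebra_simps)
  have conv: "coeff (1 - \<rho> * A) k = (\<Sum>i=0..k. coeff \<rho> i * (fps_nth f (k - i) - coeff A (k - i)))" for k
    using arg_cong[OF eq, of "\<lambda>g. fps_nth g k"] by (simp add: fps_mult_nth del: coeff_diff)
  have low: "coeff (1 - \<rho> * A) k = (if k < m then 0 else fps_nth f m)" if "k \<le> m" for k
  proof (cases "k = m")
    case True
    have "coeff (1 - \<rho> * A) m = (\<Sum>i=0..m. coeff \<rho> i * (fps_nth f (m - i) - coeff A (m - i)))"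
      by (rule conv)
    also have "\<dots> = (\<Sum>i=0..m. if i = 0 then fps_nth f m else 0)"
      using \<open>coeff \<rho> 0 = 1\<close> Suc by (intro sum.cong) (auto simp: coeff_A)
    finally show ?thesis using True by simp
  qed (use that in \<open>auto simp: conv coeff_A simp del: coeff_diff intro!: sum.neutral\<close>)
  then have "monom 1 m dvd 1 - \<rho> * A"
    by (simp add: monom_1_dvd_iff')
  then obtain P where P: "1 - \<rho> * A = monom 1 m * P"
    by (elim dvdE)
  have "coeff P 0 = fps_nth f m"
    using low[of m] by (simp add: P coeff_monom_mult)
  then have P0: "poly P 0 \<ge> 0"
    using f(2) by (simp add: poly_0_coeff_0)
  have "degree \<rho> \<le> card S"
  proof -
    have "degree \<rho> \<le> (\<Sum>i\<in>S. degree [:1, - r i:])"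
      unfolding \<rho>_def using degree_prod_sum_le[OF S(1), of "\<lambda>i. [:1, - r i:]"] by (simp add: o_def)
    also have "\<dots> \<le> (\<Sum>i\<in>S. 1)"
      by (intro sum_mono) simp
    finally show ?thesis by simp
  qed
  moreover have "degree A \<le> l"
    using Suc by (intro degree_le) (auto simp: coeff_A)
  ultimately have "degree (\<rho> * A) \<le> card S + l"
    by (meson add_mono degree_mult_le order.trans)
  then have "degree (1 - \<rho> * A) \<le> card S + l"
    by (intro degree_diff_le) auto
  \<comment> \<open>Dividing by \<open>t^m\<close> with \<open>m = l + 1\<close> removes one degree
    more than \<open>A\<close> contributes. This gain keeps \<open>P(x^2)\<close> within the range
    of exact quadrature.\<close>
  then have "degree P \<le> card S - 1"
    by (cases "P = 0") (auto simp: P degree_mult_eq degree_monom_eq Suc)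
  moreover have "poly A t \<ge> 0" if "t \<ge> 0" for t
    using that f(2) by (auto simp: A_def poly_sum poly_monom intro!: sum_nonneg)
  ultimately show ?thesis
    using that P P0 by blast
qed

text \<open>A negative exponent is wanted here: the singularity at 0 is integrable on
  \<open>[0, 1]\<close> and, by reflection, on \<open>[-1, 0]\<close>; elsewhere the exponential
  bound suffices.\<close>

lemma integrable_abs_powr_gaussian:
  assumes "s > -1"
  shows "integrable lborel (\<lambda>x::real. \<bar>x\<bar> powr s * exp (- x\<^sup>2))"
proof (rule Bochner_Integration.integrable_bound)
  let ?g = "\<lambda>x::real. indicator {0..1} x * x powr s"
  have "(\<lambda>x. x powr s) absolutely_integrable_on {0..1::real}"
    using integrable_on_powr_from_0[of s 1] assms by (intro nonnegative_absolutely_integrable_1) auto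
  then have "integrable lebesgue ?g"
    by (simp add: set_integrable_def)
  then have g: "integrable lborel ?g"
    by (subst (asm) integrable_completion) auto
  have g': "integrable lborel (\<lambda>x. ?g (0 + (-1) * x))"
    using g by (intro lborel_integrable_real_affine) auto
  show "integrable lborel (\<lambda>x. ?g x + ?g (0 + (-1) * x) + exp (\<bar>s\<bar> * \<bar>x\<bar> - x\<^sup>2))"
    by (intro Bochner_Integration.integrable_add g g' integrable_exp_abs_minus_square)
  show "AE x in lborel. norm (\<bar>x\<bar> powr s * exp (- x\<^sup>2))
      \<le> norm (?g x + ?g (0 + (-1) * x) + exp (\<bar>s\<bar> * \<bar>x\<bar> - x\<^sup>2))"
  proof (rule AE_I2)
    fix x :: real
    have "\<bar>x\<bar> powr s * exp (- x\<^sup>2) \<le> ?g x + ?g (0 + (-1) * x) + exp (\<bar>s\<bar> * \<bar>x\<bar> - x\<^sup>2)"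
    proof (cases "\<bar>x\<bar> \<le> 1")
      case True
      have "\<bar>x\<bar> powr s * exp (- x\<^sup>2) \<le> \<bar>x\<bar> powr s * 1"
        by (intro mult_left_mono) auto
      also have "\<dots> \<le> ?g x + ?g (0 + (-1) * x)"
        using True by (cases "x \<ge> 0") (auto simp: indicator_def)
      finally show ?thesis
        by (simp add: add_increasing2)
    next
      case False
      have "\<bar>x\<bar> powr s \<le> \<bar>x\<bar> powr \<bar>s\<bar>"
        using False by (intro powr_mono) auto
      also have "\<dots> \<le> exp \<bar>x\<bar> powr \<bar>s\<bar>"
        using le_exp by (intro powr_mono2) auto
      also have "\<dots> = exp (\<bar>s\<bar> * \<bar>x\<bar>)"
        by (simp add: exp_powr_real mult.commute)
      finally have "\<bar>x\<bar> powr s * exp (- x\<^sup>2) \<le> exp (\<bar>s\<bar> * \<bar>x\<bar>) * exp (- x\<^sup>2)"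
        by (intro mult_right_mono) auto
      also have "\<dots> = exp (\<bar>s\<bar> * \<bar>x\<bar> - x\<^sup>2)"
        by (simp add: exp_diff exp_minus divide_inverse)
      finally show ?thesis
        by (simp add: add_increasing)
    qed
    moreover have "?g x + ?g (0 + (-1) * x) + exp (\<bar>s\<bar> * \<bar>x\<bar> - x\<^sup>2) \<ge> 0"
      by (intro add_nonneg_nonneg) auto
    ultimately show "norm (\<bar>x\<bar> powr s * exp (- x\<^sup>2))
      \<le> norm (?g x + ?g (0 + (-1) * x) + exp (\<bar>s\<bar> * \<bar>x\<bar> - x\<^sup>2))"
      by simp
  qed
qed simp

text \<open>\<open>R(x) = P(x^2)\<close> equals \<open>x^(-2m)\<close> at the nonzero nodes, where
  \<open>\<rho>\<close> vanishes, and is at most \<open>x^(-2m)\<close> elsewhere, because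
  \<open>\<rho>\<close> and \<open>A\<close> are nonnegative at \<open>x^2\<close>. The hypothesis
  on \<open>m\<close> says that the exponent on the right exceeds -1.\<close>

lemma quad_inverse_power_le:
  assumes mu: "mu \<ge> 0" and n: "n \<ge> 1" and m: "real m < mu + 1/2"
  shows "(\<Sum>y\<in>herm_roots mu n - {0}. gauss_weight mu n y * (1 / y\<^sup>2) ^ m)
    \<le> (LINT x|lborel. \<bar>x\<bar> powr (2 * mu - 2 * real m) * exp (- x\<^sup>2))"
proof -
  let ?Z = "herm_roots mu n - {0}"
  define \<rho> where "\<rho> = (\<Prod>z\<in>?Z. [:1, - (1 / z\<^sup>2):])"
  obtain P A where PA: "degree P \<le> card ?Z - 1" "poly P 0 \<ge> 0" "\<And>t. t \<ge> 0 \<Longrightarrow> poly A t \<ge> 0"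
    "1 - \<rho> * A = monom 1 m * P"
    using inverse_power_interpolation[of ?Z "\<lambda>z. 1 / z\<^sup>2" m] unfolding \<rho>_def by auto
  have rho: "poly \<rho> (x\<^sup>2) = (\<Prod>z\<in>?Z. 1 - x\<^sup>2 / z\<^sup>2)" for x
    by (simp add: \<rho>_def poly_prod)
  have P: "(x\<^sup>2) ^ m * poly P (x\<^sup>2) = 1 - poly \<rho> (x\<^sup>2) * poly A (x\<^sup>2)" for x
    using arg_cong[OF PA(4), of "\<lambda>p. poly p (x\<^sup>2)"] by (simp add: poly_monom)
  define R where "R = pcompose P [:0, 0, 1:]"
  have poly_R: "poly R x = poly P (x\<^sup>2)" for x
    by (simp add: R_def poly_pcompose power2_eq_square)
  have "card ?Z \<le> n"
    using card_mono[of "herm_roots mu n" ?Z] card_herm_roots[OF mu, of n] by auto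
  \<comment> \<open>The degree is at most \<open>2 (card ?Z - 1)\<close>, so exactness holds whether
    or not 0 is a node.\<close>
  then have "degree R \<le> 2 * n - 1"
    using PA(1) n by (simp add: R_def degree_pcompose)
  then have quad: "quad mu n R = hint mu R"
    by (rule quad_exact[OF mu n])
  have "(\<Sum>y\<in>?Z. gauss_weight mu n y * (1 / y\<^sup>2) ^ m) = (\<Sum>y\<in>?Z. gauss_weight mu n y * poly R y)"
  proof (rule sum.cong)
    fix y assume y: "y \<in> ?Z"
    then have "poly \<rho> (y\<^sup>2) = 0"
      unfolding rho by (intro prod_zero) auto
    then have "poly R y = (1 / y\<^sup>2) ^ m"
      using P[of y] y by (simp add: poly_R field_simps)
    then show "gauss_weight mu n y * (1 / y\<^sup>2) ^ m = gauss_weight mu n y * poly R y"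
      by simp
  qed simp
  \<comment> \<open>A possible node at 0 only adds a nonnegative term, since
    \<open>P(0) \<ge> 0\<close>.\<close>
  also have "\<dots> \<le> quad mu n R"
    unfolding quad_def using PA(2) less_imp_le[OF gauss_weight_pos[OF mu n]]
    by (intro sum_mono2) (auto simp: poly_R)
  also have "\<dots> \<le> (LINT x|lborel. \<bar>x\<bar> powr (2 * mu - 2 * real m) * exp (- x\<^sup>2))"
    unfolding quad hint_def
  proof (intro integral_mono integrable_poly_hweight[OF mu])
    show "integrable lborel (\<lambda>x. \<bar>x\<bar> powr (2 * mu - 2 * real m) * exp (- x\<^sup>2))"
      using m by (intro integrable_abs_powr_gaussian) simp
    fix x :: real
    show "poly R x * hweight mu x * exp (- x\<^sup>2) \<le> \<bar>x\<bar> powr (2 * mu - 2 * real m) * exp (- x\<^sup>2)"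
    proof (cases "x = 0")
      case False
      have "(x\<^sup>2) ^ m * poly P (x\<^sup>2) \<le> 1"
        unfolding P using PA(3)[of "x\<^sup>2"] prod_herm_roots_nonneg[of x mu n] by (simp add: rho)
      then have "poly R x \<le> 1 / (x\<^sup>2) ^ m"
        using False by (simp add: poly_R field_simps)
      moreover have "(x\<^sup>2) ^ m = \<bar>x\<bar> powr (2 * real m)"
        using False powr_realpow[of "\<bar>x\<bar>" "2 * m"] by (simp add: power_mult)
      ultimately have "poly R x * hweight mu x \<le> 1 / \<bar>x\<bar> powr (2 * real m) * hweight mu x"
        by (intro mult_right_mono) auto
      then show ?thesis
        by (intro mult_right_mono) (auto simp: hweight_def powr_diff)
    qed (simp add: hweight_def)
  qed
  finally show ?thesis .
qed

text \<open>With \<open>m\<close> such that \<open>m < \<mu> + 1/2 \<le> m + 1\<close>, \<open>\<bar>y\<bar> powr (-2\<mu>)\<close> is at most \<open>y\<^sup>-\<^sup>2\<^sup>m\<close> times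
  \<open>1 / \<bar>y\<bar>\<close>, and the latter is at most of order \<open>\<surd>n\<close>.\<close>

lemma small_nodes_le:
  assumes mu: "mu \<ge> 0"
  obtains C where "C > 0" "\<And>n. n \<ge> 1 \<Longrightarrow>
    (\<Sum>y | y \<in> herm_roots mu n \<and> 0 < \<bar>y\<bar> \<and> \<bar>y\<bar> < 1. gauss_weight mu n y / hweight mu y) \<le> C * sqrt (real (n div 2))"
proof -
  \<comment> \<open>The smallest natural number with \<open>mu \<le> m + 1/2\<close>;
    \<open>nat\<close> supplies \<open>m = 0\<close> when \<open>mu \<le> 1/2\<close>.\<close>
  define m where "m = nat \<lceil>mu - 1/2\<rceil>"
  have m: "real m < mu + 1/2" "mu \<le> real m + 1/2"
    using mu unfolding m_def by linarith+
  define I where "I = (LINT x|lborel. \<bar>x\<bar> powr (2 * mu - 2 * real m) * exp (- x\<^sup>2))"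
  have I: "I \<ge> 0"
    unfolding I_def by (intro integral_nonneg_AE) auto
  show thesis
  proof (rule that[of "2 * I + 1"])
    show "2 * I + 1 > 0" using I by simp
    fix n :: nat assume n: "n \<ge> 1"
    let ?s = "sqrt (real (n div 2))"
    have le: "gauss_weight mu n y / hweight mu y \<le> 2 * ?s * (gauss_weight mu n y * (1 / y\<^sup>2) ^ m)"
      if y: "y \<in> herm_roots mu n" "0 < \<bar>y\<bar>" "\<bar>y\<bar> < 1" for y
    proof -
      have "sqrt (1 / y\<^sup>2) \<le> sqrt (4 * real (n div 2))"
        using herm_root_lower_bound[OF mu y(1)] y(2) by (intro real_sqrt_le_mono) auto
      then have 1: "1 / \<bar>y\<bar> \<le> 2 * ?s"
        by (simp add: real_sqrt_divide real_sqrt_mult)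
      \<comment> \<open>For \<open>|y| < 1\<close> the larger exponent gives the smaller
        power.\<close>
      have "\<bar>y\<bar> powr (2 * real m + 1) \<le> hweight mu y"
        unfolding hweight_def using y m by (intro powr_mono') auto
      then have "1 / hweight mu y \<le> 1 / \<bar>y\<bar> powr (2 * real m + 1)"
        using y by (intro divide_left_mono mult_pos_pos hweight_pos) auto
      also have "\<bar>y\<bar> powr (2 * real m + 1) = (y\<^sup>2) ^ m * \<bar>y\<bar>"
        using y powr_realpow[of "\<bar>y\<bar>" "2 * m"] by (simp add: powr_add power_mult)
      also have "1 / ((y\<^sup>2) ^ m * \<bar>y\<bar>) = (1 / y\<^sup>2) ^ m * (1 / \<bar>y\<bar>)"
        by (simp add: power_divide)
      also have "\<dots> \<le> (1 / y\<^sup>2) ^ m * (2 * ?s)"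
        using 1 by (intro mult_left_mono) auto
      finally have "gauss_weight mu n y * (1 / hweight mu y) \<le> gauss_weight mu n y * ((1 / y\<^sup>2) ^ m * (2 * ?s))"
        using gauss_weight_pos[OF mu n y(1)] by (intro mult_left_mono) auto
      then show ?thesis by (simp add: mult_ac)
    qed
    have "(\<Sum>y | y \<in> herm_roots mu n \<and> 0 < \<bar>y\<bar> \<and> \<bar>y\<bar> < 1. gauss_weight mu n y / hweight mu y)
        \<le> (\<Sum>y | y \<in> herm_roots mu n \<and> 0 < \<bar>y\<bar> \<and> \<bar>y\<bar> < 1. 2 * ?s * (gauss_weight mu n y * (1 / y\<^sup>2) ^ m))"
      using le by (intro sum_mono) auto
    also have "\<dots> \<le> (\<Sum>y\<in>herm_roots mu n - {0}. 2 * ?s * (gauss_weight mu n y * (1 / y\<^sup>2) ^ m))"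
      using less_imp_le[OF gauss_weight_pos[OF mu n]] by (intro sum_mono2) auto
    also have "\<dots> = 2 * ?s * (\<Sum>y\<in>herm_roots mu n - {0}. gauss_weight mu n y * (1 / y\<^sup>2) ^ m)"
      by (simp add: sum_distrib_left)
    also have "\<dots> \<le> 2 * ?s * I"
      using quad_inverse_power_le[OF mu n m(1)] unfolding I_def by (intro mult_left_mono) auto
    also have "\<dots> \<le> (2 * I + 1) * ?s"
      by (simp add: algebra_simps)
    finally show "(\<Sum>y | y \<in> herm_roots mu n \<and> 0 < \<bar>y\<bar> \<and> \<bar>y\<bar> < 1. gauss_weight mu n y / hweight mu y) \<le> (2 * I + 1) * ?s" .
  qed
qed

section \<open>Values at the nodes\<close>

text \<open>Cauchy-Schwarz, obtained by expanding the nonnegative integral of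
  \<open>(w' - m)^2\<close> with \<open>m\<close> the mean slope. The derivative is given only
  through the increments of \<open>w\<close>, as a gauge integral; square integrability makes it a
  Lebesgue integral.\<close>

lemma increment_square_le:
  fixes w w' :: "real \<Rightarrow> real"
  assumes "s \<le> t" and [measurable]: "w' \<in> borel_measurable borel"
    and w': "(w' has_integral (w t - w s)) {s..t}"
    and int: "set_integrable lborel {s..t} (\<lambda>x. (w' x)\<^sup>2)"
  shows "(w t - w s)\<^sup>2 \<le> (t - s) * (LINT x:{s..t}|lborel. (w' x)\<^sup>2)"
proof (cases "s = t")
  case True
  then show ?thesis by simp
next
  case False
  define l where "l = t - s"
  have l: "l > 0" using assms(1) False by (simp add: l_def)
  define m where "m = (w t - w s) / l"
  have const: "set_integrable lborel {s..t} (\<lambda>x. c::real)" for c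
    by (intro borel_integrable_atLeastAtMost' continuous_intros)
  have int1: "set_integrable lborel {s..t} w'"
  proof (rule set_integrable_bound[OF set_integral_add(1)[OF const[of 1] int]])
    show "AE x in lborel. x \<in> {s..t} \<longrightarrow> norm (w' x) \<le> norm (1 + (w' x)\<^sup>2)"
    proof (intro AE_I2 impI)
      fix x
      have "0 \<le> (\<bar>w' x\<bar> - 1/2)\<^sup>2" by simp
      then have "\<bar>w' x\<bar> \<le> 1 + (w' x)\<^sup>2"
        by (simp add: power2_eq_square algebra_simps)
      then show "norm (w' x) \<le> norm (1 + (w' x)\<^sup>2)" by simp
    qed
  qed (simp add: set_borel_measurable_def)
  have I: "(LINT x:{s..t}|lborel. w' x) = w t - w s"
    using set_borel_integral_eq_integral(2)[OF int1] w' by (simp add: integral_unique)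
  have len: "(LINT x:{s..t}|lborel. c) = c * l" for c :: real
    using assms(1) by (simp add: set_lebesgue_integral_def l_def)
  have mint: "set_integrable lborel {s..t} (\<lambda>x. 2 * m * w' x)"
    using int1 by simp
  have "0 \<le> (LINT x:{s..t}|lborel. (w' x - m)\<^sup>2)"
    unfolding set_lebesgue_integral_def by (intro integral_nonneg_AE) auto
  also have "\<dots> = (LINT x:{s..t}|lborel. ((w' x)\<^sup>2 - 2 * m * w' x) + m\<^sup>2)"
    by (simp add: power2_eq_square algebra_simps)
  also have "\<dots> = (LINT x:{s..t}|lborel. (w' x)\<^sup>2) - 2 * m * (w t - w s) + m\<^sup>2 * l"
    by (simp only: set_integral_add(2)[OF set_integral_diff(1)[OF int mint] const]
        set_integral_diff(2)[OF int mint] set_integral_mult_right I len)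
  also have "\<dots> = (LINT x:{s..t}|lborel. (w' x)\<^sup>2) - (w t - w s)\<^sup>2 / l"
    using l by (simp add: m_def power2_eq_square field_simps)
  finally show ?thesis
    using l by (simp add: l_def field_simps)
qed

text \<open>Averages \<open>w(y)^2 \<le> 2 w(z)^2 + 2 (w(y) - w(z))^2\<close> over \<open>z\<close>
  in the interval, the increment being bounded by the integral of \<open>w'^2\<close>.\<close>

lemma pointwise_square_le:
  fixes w w' :: "real \<Rightarrow> real"
  assumes y: "y \<in> {a..b}" and cont: "continuous_on {a..b} w"
    and meas[measurable]: "w' \<in> borel_measurable borel"
    and w': "\<And>s t. s \<le> t \<Longrightarrow> (w' has_integral (w t - w s)) {s..t}"
    and int: "set_integrable lborel {a..b} (\<lambda>x. (w' x)\<^sup>2)"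
  shows "(b - a) * (w y)\<^sup>2
    \<le> 2 * (LINT x:{a..b}|lborel. (w x)\<^sup>2) + 2 * (b - a)\<^sup>2 * (LINT x:{a..b}|lborel. (w' x)\<^sup>2)"
proof -
  define B where "B = (LINT x:{a..b}|lborel. (w' x)\<^sup>2)"
  have B: "B \<ge> 0"
    unfolding B_def set_lebesgue_integral_def by (intro integral_nonneg_AE) auto
  have incr: "(w t - w s)\<^sup>2 \<le> (b - a) * B" if "a \<le> s" "s \<le> t" "t \<le> b" for s t
  proof -
    have sub: "set_integrable lborel {s..t} (\<lambda>x. (w' x)\<^sup>2)"
      by (rule set_integrable_subset[OF int]) (use that in auto)
    have "(w t - w s)\<^sup>2 \<le> (t - s) * (LINT x:{s..t}|lborel. (w' x)\<^sup>2)"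
      by (rule increment_square_le[OF that(2) meas w'[OF that(2)] sub])
    also have "\<dots> \<le> (b - a) * B"
    proof (intro mult_mono)
      show "(LINT x:{s..t}|lborel. (w' x)\<^sup>2) \<le> B"
        unfolding B_def set_lebesgue_integral_def
        using int sub that by (intro integral_mono) (auto simp: set_integrable_def indicator_def)
      show "(LINT x:{s..t}|lborel. (w' x)\<^sup>2) \<ge> 0"
        unfolding set_lebesgue_integral_def by (intro integral_nonneg_AE) auto
    qed (use that in auto)
    finally show ?thesis .
  qed
  have le: "(w y)\<^sup>2 \<le> 2 * (w z)\<^sup>2 + 2 * ((b - a) * B)" if z: "z \<in> {a..b}" for z
  proof -
    have "(w y - w z)\<^sup>2 \<le> (b - a) * B"
      using incr[of y z] incr[of z y] y z by (cases "y \<le> z") (auto simp: power2_commute)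
    moreover have "0 \<le> (w y - 2 * w z)\<^sup>2"
      by simp
    ultimately show ?thesis
      by (simp add: power2_eq_square algebra_simps)
  qed
  have const: "set_integrable lborel {a..b} (\<lambda>x. c::real)" for c
    by (intro borel_integrable_atLeastAtMost' continuous_intros)
  have len: "(LINT x:{a..b}|lborel. c) = (b - a) * c" for c :: real
    using y by (simp add: set_lebesgue_integral_def)
  have intw: "set_integrable lborel {a..b} (\<lambda>x. 2 * (w x)\<^sup>2)"
    by (intro borel_integrable_atLeastAtMost' continuous_intros cont)
  have "(b - a) * (w y)\<^sup>2 = (LINT x:{a..b}|lborel. (w y)\<^sup>2)"
    by (simp add: len)
  also have "\<dots> \<le> (LINT x:{a..b}|lborel. 2 * (w x)\<^sup>2 + 2 * ((b - a) * B))"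
    by (rule set_integral_mono[OF const set_integral_add(1)[OF intw const] le])
  also have "\<dots> = 2 * (LINT x:{a..b}|lborel. (w x)\<^sup>2) + (b - a) * (2 * ((b - a) * B))"
    by (simp only: set_integral_add(2)[OF intw const] set_integral_mult_right len)
  finally show ?thesis
    by (simp add: B_def power2_eq_square)
qed

text \<open>The interval is taken on the side of \<open>y\<close> away from the origin, where the weight is at least its
  value at \<open>y\<close>.\<close>

definition outer_interval :: "real \<Rightarrow> real \<Rightarrow> real set" where
  "outer_interval y d = (if y > 0 then {y..y + d} else {y - d..y})"

lemma outer_intervalD: "x \<in> outer_interval y d \<Longrightarrow> y \<noteq> 0 \<Longrightarrow> \<bar>y\<bar> \<le> \<bar>x\<bar> \<and> \<bar>x\<bar> \<le> \<bar>y\<bar> + d"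
  by (auto simp: outer_interval_def split: if_splits)

lemma outer_interval_sets [measurable]: "outer_interval y d \<in> sets borel"
  by (simp add: outer_interval_def)

section \<open>Sums over the nodes\<close>

context
  fixes mu :: real and w w' :: "real \<Rightarrow> real"
  assumes mu: "mu \<ge> 0" and cont: "continuous_on UNIV w"
    and w': "\<And>s t. s \<le> t \<Longrightarrow> (w' has_integral (w t - w s)) {s..t}"
    and L2w: "in_L2w mu w" and L2w': "in_L2w mu w'"
begin

lemma measurable_w: "w \<in> borel_measurable borel" "w' \<in> borel_measurable borel"
  using L2w L2w' by (simp_all add: in_L2w_def)

lemma integrable_w:
  "integrable lborel (\<lambda>x. (w x)\<^sup>2 * hweight mu x)" "integrable lborel (\<lambda>x. (w' x)\<^sup>2 * hweight mu x)"
  using L2w L2w' by (simp_all add: in_L2w_def)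

lemma hweight_mono: "\<bar>y\<bar> \<le> \<bar>x\<bar> \<Longrightarrow> hweight mu y \<le> hweight mu x"
  unfolding hweight_def using mu by (intro powr_mono2) auto

lemma outer_interval_bounds:
  assumes y: "y \<noteq> 0" and f: "integrable lborel (\<lambda>x. (f x)\<^sup>2 * hweight mu x)"
    and [measurable]: "f \<in> borel_measurable borel"
  shows "set_integrable lborel (outer_interval y d) (\<lambda>x. (f x)\<^sup>2)"
    and "hweight mu y * (LINT x:outer_interval y d|lborel. (f x)\<^sup>2) \<le> (LINT x|lborel. (f x)\<^sup>2 * hweight mu x)"
proof -
  have pos: "hweight mu y > 0" using y by (rule hweight_pos)
  have le: "hweight mu y * (indicator (outer_interval y d) x * (f x)\<^sup>2) \<le> (f x)\<^sup>2 * hweight mu x" for x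
    using hweight_mono[of y x] outer_intervalD[of x y d] y
    by (cases "x \<in> outer_interval y d") (auto simp: mult.commute[of _ "hweight mu x"] intro: mult_right_mono)
  show 1: "set_integrable lborel (outer_interval y d) (\<lambda>x. (f x)\<^sup>2)"
    unfolding set_integrable_def
  proof (rule Bochner_Integration.integrable_bound)
    show "integrable lborel (\<lambda>x. (f x)\<^sup>2 * hweight mu x / hweight mu y)"
      using f by simp
    show "AE x in lborel. norm (indicator (outer_interval y d) x *\<^sub>R (f x)\<^sup>2) \<le> norm ((f x)\<^sup>2 * hweight mu x / hweight mu y)"
      using le pos by (intro AE_I2) (simp add: field_simps)
  qed simp
  have "hweight mu y * (LINT x:outer_interval y d|lborel. (f x)\<^sup>2)
      = (LINT x|lborel. hweight mu y * (indicator (outer_interval y d) x * (f x)\<^sup>2))"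
    by (simp add: set_lebesgue_integral_def)
  also have "\<dots> \<le> (LINT x|lborel. (f x)\<^sup>2 * hweight mu x)"
    using 1 f le by (intro integral_mono) (auto simp: set_integrable_def)
  finally show "hweight mu y * (LINT x:outer_interval y d|lborel. (f x)\<^sup>2) \<le> (LINT x|lborel. (f x)\<^sup>2 * hweight mu x)" .
qed

lemma node_value_le:
  assumes y: "y \<noteq> 0" and d: "d > 0"
  shows "d * (w y)\<^sup>2 \<le> 2 * (LINT x:outer_interval y d|lborel. (w x)\<^sup>2)
    + 2 * d\<^sup>2 * (LINT x:outer_interval y d|lborel. (w' x)\<^sup>2)"
proof -
  define a where "a = (if y > 0 then y else y - d)"
  have I: "outer_interval y d = {a..a + d}"
    by (auto simp: outer_interval_def a_def)
  have "(a + d - a) * (w y)\<^sup>2 \<le> 2 * (LINT x:{a..a + d}|lborel. (w x)\<^sup>2)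
    + 2 * (a + d - a)\<^sup>2 * (LINT x:{a..a + d}|lborel. (w' x)\<^sup>2)"
    using outer_interval_bounds(1)[OF y integrable_w(2) measurable_w(2), of d] d
    by (intro pointwise_square_le w' measurable_w continuous_on_subset[OF cont])
       (auto simp: I a_def)
  then show ?thesis by (simp add: I)
qed

text \<open>On the outer interval the factor \<open>hweight mu y\<close> is at most the weight, so
  local integrals become global weighted ones. The length \<open>d\<close> stays free so that the
  two terms can be balanced.\<close>

lemma node_value_weighted_le:
  assumes y: "y \<noteq> 0" and d: "d > 0"
  shows "hweight mu y * (w y)\<^sup>2 \<le> 2 / d * (LINT x|lborel. (w x)\<^sup>2 * hweight mu x)
    + 2 * d * (LINT x|lborel. (w' x)\<^sup>2 * hweight mu x)"
proof -
  have "hweight mu y * (d * (w y)\<^sup>2) \<le> hweight mu y * (2 * (LINT x:outer_interval y d|lborel. (w x)\<^sup>2)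
    + 2 * d\<^sup>2 * (LINT x:outer_interval y d|lborel. (w' x)\<^sup>2))"
    using node_value_le[OF y d] by (rule mult_left_mono) simp
  also have "\<dots> = 2 * (hweight mu y * (LINT x:outer_interval y d|lborel. (w x)\<^sup>2))
    + 2 * d\<^sup>2 * (hweight mu y * (LINT x:outer_interval y d|lborel. (w' x)\<^sup>2))"
    by (simp add: algebra_simps)
  also have "\<dots> \<le> 2 * (LINT x|lborel. (w x)\<^sup>2 * hweight mu x) + 2 * d\<^sup>2 * (LINT x|lborel. (w' x)\<^sup>2 * hweight mu x)"
    using outer_interval_bounds(2)[OF y integrable_w(1) measurable_w(1), of d]
      outer_interval_bounds(2)[OF y integrable_w(2) measurable_w(2), of d]
    by (intro add_mono mult_left_mono) auto
  finally show ?thesis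
    using d by (simp add: field_simps power2_eq_square)
qed

lemma small_nodes_sum_le:
  assumes n: "n \<ge> 1" and N: "N \<ge> 1" "n div 2 \<le> 2 * N" and C: "C \<ge> 0"
    and sum: "(\<Sum>y | y \<in> herm_roots mu n \<and> 0 < \<bar>y\<bar> \<and> \<bar>y\<bar> < 1. gauss_weight mu n y / hweight mu y) \<le> C * sqrt (real (n div 2))"
  shows "(\<Sum>y | y \<in> herm_roots mu n \<and> 0 < \<bar>y\<bar> \<and> \<bar>y\<bar> < 1. gauss_weight mu n y * exp (y\<^sup>2) * (w y)\<^sup>2)
    \<le> 4 * exp 1 * C * (real N * (LINT x|lborel. (w x)\<^sup>2 * hweight mu x) + (LINT x|lborel. (w' x)\<^sup>2 * hweight mu x))"
proof -
  let ?A = "LINT x|lborel. (w x)\<^sup>2 * hweight mu x" and ?B = "LINT x|lborel. (w' x)\<^sup>2 * hweight mu x"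
  let ?Z = "{y. y \<in> herm_roots mu n \<and> 0 < \<bar>y\<bar> \<and> \<bar>y\<bar> < 1}"
  have AB: "?A \<ge> 0" "?B \<ge> 0"
    by (auto intro!: integral_nonneg_AE)
  \<comment> \<open>The intervals have length \<open>1 / s\<close>, so a node contributes
    \<open>2 s A + (2 / s) B\<close>. The sum of the weights supplies one more factor of order
    \<open>s\<close>, which gives \<open>N A + B\<close>.\<close>
  define s where "s = sqrt (real N)"
  have s: "s > 0" "s\<^sup>2 = real N" using N by (auto simp: s_def)
  define M where "M = exp 1 * (2 * s * ?A + 2 / s * ?B)"
  have M: "M \<ge> 0" using AB s by (simp add: M_def)
  have tm: "gauss_weight mu n y * exp (y\<^sup>2) * (w y)\<^sup>2 \<le> gauss_weight mu n y / hweight mu y * M" if y: "y \<in> ?Z" for y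
  proof -
    have y0: "y \<noteq> 0" using y by auto
    have "y\<^sup>2 \<le> 1" using y by (auto simp: abs_square_le_1)
    then have "exp (y\<^sup>2) \<le> exp 1" by simp
    moreover have "hweight mu y * (w y)\<^sup>2 \<le> 2 * s * ?A + 2 / s * ?B"
      using node_value_weighted_le[OF y0, of "1 / s"] s by simp
    ultimately have "exp (y\<^sup>2) * (hweight mu y * (w y)\<^sup>2) \<le> M"
      unfolding M_def by (intro mult_mono) auto
    then have "gauss_weight mu n y / hweight mu y * (exp (y\<^sup>2) * (hweight mu y * (w y)\<^sup>2)) \<le> gauss_weight mu n y / hweight mu y * M"
      using gauss_weight_pos[OF mu n, of y] y by (intro mult_left_mono) auto
    then show ?thesis
      using hweight_pos[OF y0, of mu] by simp
  qed
  have "(\<Sum>y\<in>?Z. gauss_weight mu n y * exp (y\<^sup>2) * (w y)\<^sup>2) \<le> (\<Sum>y\<in>?Z. gauss_weight mu n y / hweight mu y) * M"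
    unfolding sum_distrib_right by (rule sum_mono) (rule tm)
  also have "\<dots> \<le> (C * sqrt (real (n div 2))) * M"
    using sum M by (rule mult_right_mono)
  also have "\<dots> \<le> (C * (2 * s)) * M"
  proof (intro mult_right_mono mult_left_mono C M)
    have "sqrt (real (n div 2)) \<le> sqrt (4 * real N)"
      using N by (intro real_sqrt_le_mono) linarith
    then show "sqrt (real (n div 2)) \<le> 2 * s"
      by (simp add: s_def real_sqrt_mult)
  qed
  also have "\<dots> = 4 * exp 1 * C * (s\<^sup>2 * ?A + ?B)"
    using s by (simp add: M_def power2_eq_square field_simps)
  finally show ?thesis
    unfolding s(2) .
qed

lemma large_nodes_sum_le:
  assumes n: "n \<ge> 1" and C: "C \<ge> 0"
    and sum: "\<And>a. a \<ge> 0 \<Longrightarrow>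
      (\<Sum>y\<in>herm_roots mu n. gauss_weight mu n y * exp (2 * a * \<bar>y\<bar>)) \<le> C * exp (a\<^sup>2) * (1 + a) powr (2 * mu)"
  shows "(\<Sum>y | y \<in> herm_roots mu n \<and> 1 \<le> \<bar>y\<bar>. gauss_weight mu n y * exp (y\<^sup>2) * (w y)\<^sup>2)
    \<le> 2 * exp 1 * 2 powr (2 * mu) * C
      * ((LINT x|lborel. (w x)\<^sup>2 * hweight mu x) + (LINT x|lborel. (w' x)\<^sup>2 * hweight mu x))"
proof -
  let ?A = "LINT x|lborel. (w x)\<^sup>2 * hweight mu x" and ?B = "LINT x|lborel. (w' x)\<^sup>2 * hweight mu x"
  let ?Z = "{y. y \<in> herm_roots mu n \<and> 1 \<le> \<bar>y\<bar>}"
  let ?g = "\<lambda>x. 2 * (w x)\<^sup>2 + 2 * (w' x)\<^sup>2"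
  let ?l = "\<lambda>y. gauss_weight mu n y * exp (y\<^sup>2)"
  define K where "K = exp 1 * 2 powr (2 * mu) * C"
  have l0: "?l y \<ge> 0" if "y \<in> ?Z" for y
    using gauss_weight_pos[OF mu n, of y] that by simp
  have int: "set_integrable lborel (outer_interval y 1) ?g" if "y \<in> ?Z" for y
  proof -
    have "y \<noteq> 0" using that by auto
    then show ?thesis
      using outer_interval_bounds(1)[OF _ integrable_w(1) measurable_w(1), of y 1]
        outer_interval_bounds(1)[OF _ integrable_w(2) measurable_w(2), of y 1]
      by (intro set_integral_add(1)) auto
  qed
  have node: "(w y)\<^sup>2 \<le> (LINT x:outer_interval y 1|lborel. ?g x)" if "y \<in> ?Z" for y
  proof -
    have y0: "y \<noteq> 0" using that by auto
    note i = outer_interval_bounds(1)[OF y0 integrable_w(1) measurable_w(1), of 1]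
        outer_interval_bounds(1)[OF y0 integrable_w(2) measurable_w(2), of 1]
    have "(LINT x:outer_interval y 1|lborel. ?g x)
       = 2 * (LINT x:outer_interval y 1|lborel. (w x)\<^sup>2) + 2 * (LINT x:outer_interval y 1|lborel. (w' x)\<^sup>2)"
      using i by (subst set_integral_add(2)) auto
    then show ?thesis
      using node_value_le[OF y0, of 1] by simp
  qed
  \<comment> \<open>At fixed \<open>x\<close> only nodes with
    \<open>|x| - 1 \<le> |y| \<le> |x|\<close> contribute, and for them
    \<open>(|x| - |y|)^2 \<le> 1\<close>. Their exponential moments are thus needed at the single
    parameter \<open>a = |x|\<close>.\<close>
  have pw: "(\<Sum>y\<in>?Z. ?l y * (indicator (outer_interval y 1) x * ?g x)) \<le> K * (?g x * hweight mu x)" for x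
  proof (cases "\<bar>x\<bar> \<ge> 1")
    case False
    have "(\<Sum>y\<in>?Z. ?l y * (indicator (outer_interval y 1) x * ?g x)) = 0"
    proof (rule sum.neutral, intro ballI)
      fix y assume "y \<in> ?Z"
      then have "x \<notin> outer_interval y 1"
        using outer_intervalD[of x y 1] False by fastforce
      then show "?l y * (indicator (outer_interval y 1) x * ?g x) = 0" by simp
    qed
    then show ?thesis
      using C by (simp add: K_def)
  next
    case True
    have "(\<Sum>y\<in>?Z. ?l y * indicator (outer_interval y 1) x)
        \<le> (\<Sum>y\<in>?Z. exp (1 - x\<^sup>2) * (gauss_weight mu n y * exp (2 * \<bar>x\<bar> * \<bar>y\<bar>)))"
    proof (rule sum_mono)
      fix y assume y: "y \<in> ?Z"
      have g: "gauss_weight mu n y > 0"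
        using gauss_weight_pos[OF mu n] y by auto
      show "?l y * indicator (outer_interval y 1) x \<le> exp (1 - x\<^sup>2) * (gauss_weight mu n y * exp (2 * \<bar>x\<bar> * \<bar>y\<bar>))"
      proof (cases "x \<in> outer_interval y 1")
        case True
        then have "0 \<le> \<bar>x\<bar> - \<bar>y\<bar>" "\<bar>x\<bar> - \<bar>y\<bar> \<le> 1"
          using outer_intervalD[of x y 1] y by fastforce+
        then have "(\<bar>x\<bar> - \<bar>y\<bar>)\<^sup>2 \<le> 1"
          by (simp add: power_le_one)
        then have "y\<^sup>2 \<le> (1 - x\<^sup>2) + 2 * \<bar>x\<bar> * \<bar>y\<bar>"
          by (simp add: power2_diff)
        then have "exp (y\<^sup>2) \<le> exp (1 - x\<^sup>2) * exp (2 * \<bar>x\<bar> * \<bar>y\<bar>)"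
          by (simp flip: exp_add)
        then have "gauss_weight mu n y * exp (y\<^sup>2) \<le> gauss_weight mu n y * (exp (1 - x\<^sup>2) * exp (2 * \<bar>x\<bar> * \<bar>y\<bar>))"
          using g by (intro mult_left_mono) auto
        then show ?thesis
          using True by (simp add: mult_ac)
      qed (use g in simp)
    qed
    also have "\<dots> = exp (1 - x\<^sup>2) * (\<Sum>y\<in>?Z. gauss_weight mu n y * exp (2 * \<bar>x\<bar> * \<bar>y\<bar>))"
      by (simp add: sum_distrib_left)
    also have "(\<Sum>y\<in>?Z. gauss_weight mu n y * exp (2 * \<bar>x\<bar> * \<bar>y\<bar>))
        \<le> (\<Sum>y\<in>herm_roots mu n. gauss_weight mu n y * exp (2 * \<bar>x\<bar> * \<bar>y\<bar>))"
      using less_imp_le[OF gauss_weight_pos[OF mu n]] by (intro sum_mono2) auto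
    also have "\<dots> \<le> C * exp (x\<^sup>2) * (1 + \<bar>x\<bar>) powr (2 * mu)"
      using sum[of "\<bar>x\<bar>"] by simp
    \<comment> \<open>Here \<open>|x| \<ge> 1\<close> enters: \<open>1 + |x| \<le> 2 |x|\<close>
      recovers the weight.\<close>
    also have "\<dots> \<le> C * exp (x\<^sup>2) * (2 * \<bar>x\<bar>) powr (2 * mu)"
      using C mu True by (intro mult_left_mono powr_mono2) auto
    also have "(2 * \<bar>x\<bar>) powr (2 * mu) = 2 powr (2 * mu) * hweight mu x"
      by (simp add: powr_mult hweight_def)
    finally have "(\<Sum>y\<in>?Z. ?l y * indicator (outer_interval y 1) x)
        \<le> exp (1 - x\<^sup>2) * (C * exp (x\<^sup>2) * (2 powr (2 * mu) * hweight mu x))"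
      by (simp add: mult_left_mono)
    also have "\<dots> = K * hweight mu x"
      by (simp add: K_def exp_diff)
    finally have "(\<Sum>y\<in>?Z. ?l y * indicator (outer_interval y 1) x) * ?g x \<le> K * hweight mu x * ?g x"
      by (rule mult_right_mono) simp
    then show ?thesis
      by (simp only: sum_distrib_left sum_distrib_right mult_ac)
  qed
  have "(\<Sum>y\<in>?Z. ?l y * (w y)\<^sup>2) \<le> (\<Sum>y\<in>?Z. ?l y * (LINT x:outer_interval y 1|lborel. ?g x))"
    using node l0 by (intro sum_mono mult_left_mono) auto
  also have "\<dots> = (\<Sum>y\<in>?Z. LINT x|lborel. ?l y * (indicator (outer_interval y 1) x * ?g x))"
    by (simp only: set_lebesgue_integral_def real_scaleR_def integral_mult_right_zero)
  also have "\<dots> = (LINT x|lborel. (\<Sum>y\<in>?Z. ?l y * (indicator (outer_interval y 1) x * ?g x)))"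
    using int by (intro Bochner_Integration.integral_sum[symmetric] integrable_mult_right) (auto simp: set_integrable_def)
  also have "\<dots> \<le> (LINT x|lborel. K * (?g x * hweight mu x))"
  proof (rule integral_mono[OF _ _ pw])
    show "integrable lborel (\<lambda>x. \<Sum>y\<in>?Z. ?l y * (indicator (outer_interval y 1) x * ?g x))"
      using int by (intro Bochner_Integration.integrable_sum integrable_mult_right) (auto simp: set_integrable_def)
    show "integrable lborel (\<lambda>x. K * (?g x * hweight mu x))"
      using integrable_w by (simp add: distrib_right mult.assoc)
  qed
  also have "\<dots> = K * (2 * (?A + ?B))"
    using integrable_w by (simp add: distrib_right mult.assoc)
  also have "\<dots> = 2 * exp 1 * 2 powr (2 * mu) * C * (?A + ?B)"
    by (simp add: K_def)
  finally show ?thesis .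
qed

end

text \<open>\<open>n\<close> counts the nodes, one more than the degree of the space: odd
  \<open>n\<close> belongs to degree \<open>2 N\<close>, even \<open>n\<close> to degree
  \<open>2 N + 1\<close>.\<close>

lemma nodes_sum_le:
  assumes mu: "mu \<ge> 0"
  obtains C where "C > 0" "\<And>N n w w'. N \<ge> 1 \<Longrightarrow> n = 2 * N + 1 \<or> n = 2 * N + 2 \<Longrightarrow> continuous_on UNIV w \<Longrightarrow>
    \<forall>s t. s \<le> t \<longrightarrow> (w' has_integral (w t - w s)) {s..t} \<Longrightarrow> in_L2w mu w \<Longrightarrow> in_L2w mu w' \<Longrightarrow>
    (\<Sum>y\<in>herm_roots mu n. gauss_weight mu n y * exp (y\<^sup>2) * (w y)\<^sup>2)
      \<le> C * (real N * (LINT x|lborel. (w x)\<^sup>2 * hweight mu x) + (LINT x|lborel. (w' x)\<^sup>2 * hweight mu x)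
        + (if odd n then real N powr (- mu - 1/2) * (w 0)\<^sup>2 else 0))"
proof -
  obtain C0 where C0: "C0 > 0" "\<And>k. k \<ge> 1 \<Longrightarrow> gauss_weight mu (Suc (2 * k)) 0 \<le> C0 * real k powr (- mu - 1/2)"
    using gauss_weight_0_le[OF mu] by blast
  obtain C1 where C1: "C1 > 0" "\<And>n. n \<ge> 1 \<Longrightarrow>
    (\<Sum>y | y \<in> herm_roots mu n \<and> 0 < \<bar>y\<bar> \<and> \<bar>y\<bar> < 1. gauss_weight mu n y / hweight mu y) \<le> C1 * sqrt (real (n div 2))"
    using small_nodes_le[OF mu] by blast
  obtain C2 where C2: "C2 > 0" "\<And>n a. n \<ge> 1 \<Longrightarrow> a \<ge> 0 \<Longrightarrow>
    (\<Sum>y\<in>herm_roots mu n. gauss_weight mu n y * exp (2 * a * \<bar>y\<bar>)) \<le> C2 * exp (a\<^sup>2) * (1 + a) powr (2 * mu)"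
    using quad_exp_le[OF mu] by blast
  define D1 where "D1 = 4 * exp 1 * C1"
  define D2 where "D2 = 2 * exp 1 * 2 powr (2 * mu) * C2"
  have D: "D1 > 0" "D2 > 0"
    using C1 C2 by (simp_all add: D1_def D2_def)
  show thesis
  proof (rule that[of "D1 + D2 + C0"])
    show "D1 + D2 + C0 > 0" using D C0 by simp
    fix N n :: nat and w w' :: "real \<Rightarrow> real"
    assume N: "N \<ge> 1" and nN: "n = 2 * N + 1 \<or> n = 2 * N + 2" and cont: "continuous_on UNIV w"
      and *: "\<forall>s t. s \<le> t \<longrightarrow> (w' has_integral (w t - w s)) {s..t}"
      and L2: "in_L2w mu w" "in_L2w mu w'"
    have w': "\<And>s t. s \<le> t \<Longrightarrow> (w' has_integral (w t - w s)) {s..t}"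
      using * by blast
    let ?A = "LINT x|lborel. (w x)\<^sup>2 * hweight mu x" and ?B = "LINT x|lborel. (w' x)\<^sup>2 * hweight mu x"
    let ?O = "if odd n then real N powr (- mu - 1/2) * (w 0)\<^sup>2 else 0"
    let ?f = "\<lambda>y. gauss_weight mu n y * exp (y\<^sup>2) * (w y)\<^sup>2"
    have n: "n \<ge> 1" "n div 2 \<le> 2 * N" using nN N by auto
    have AB: "?A \<ge> 0" "?B \<ge> 0" "?O \<ge> 0"
      by (auto intro!: integral_nonneg_AE)
    \<comment> \<open>The large nodes contribute \<open>?A\<close> without the factor
      \<open>N\<close>; it is absorbed because \<open>N \<ge> 1\<close>.\<close>
    have "real N * ?A \<ge> 1 * ?A"
      using N AB by (intro mult_right_mono) auto
    then have NA: "?A \<le> real N * ?A" by simp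
    let ?S = "{y. y \<in> herm_roots mu n \<and> 0 < \<bar>y\<bar> \<and> \<bar>y\<bar> < 1}" and ?L = "{y. y \<in> herm_roots mu n \<and> 1 \<le> \<bar>y\<bar>}"
    have "herm_roots mu n = (herm_roots mu n \<inter> {0}) \<union> (?S \<union> ?L)"
      by auto
    then have "(\<Sum>y\<in>herm_roots mu n. ?f y) = (\<Sum>y\<in>(herm_roots mu n \<inter> {0}) \<union> (?S \<union> ?L). ?f y)"
      by simp
    also have "\<dots> = (\<Sum>y\<in>herm_roots mu n \<inter> {0}. ?f y) + ((\<Sum>y\<in>?S. ?f y) + (\<Sum>y\<in>?L. ?f y))"
      by (subst sum.union_disjoint; (subst sum.union_disjoint)?) auto
    also have "\<dots> \<le> C0 * ?O + (D1 * (real N * ?A + ?B) + D2 * (?A + ?B))"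
    proof (intro add_mono)
      show "(\<Sum>y\<in>?S. ?f y) \<le> D1 * (real N * ?A + ?B)"
        unfolding D1_def using small_nodes_sum_le[OF mu cont w' L2 n(1) N n(2) _ C1(2)[OF n(1)]] C1(1) by simp
      show "(\<Sum>y\<in>?L. ?f y) \<le> D2 * (?A + ?B)"
        unfolding D2_def using large_nodes_sum_le[OF mu cont w' L2 n(1) _ C2(2)[OF n(1)]] C2(1) by simp
      show "(\<Sum>y\<in>herm_roots mu n \<inter> {0}. ?f y) \<le> C0 * ?O"
      proof (cases "odd n")
        case True
        then have nk: "n = Suc (2 * N)" using nN by auto
        then have "herm_roots mu n \<inter> {0} = {0}"
          using zero_in_herm_roots_odd by auto
        then have "(\<Sum>y\<in>herm_roots mu n \<inter> {0}. ?f y) = gauss_weight mu n 0 * (w 0)\<^sup>2"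
          by simp
        also have "\<dots> \<le> (C0 * real N powr (- mu - 1/2)) * (w 0)\<^sup>2"
          unfolding nk by (intro mult_right_mono C0(2) N) simp
        finally show ?thesis using True by (simp add: mult.assoc)
      next
        case False
        then have nN: "n = 2 * Suc N" using nN by auto
        have "0 \<notin> herm_roots mu n"
          unfolding nN by (rule zero_notin_herm_roots_even[OF mu])
        then have "herm_roots mu n \<inter> {0} = {}" by simp
        then show ?thesis using False by simp
      qed
    qed
    also have "\<dots> \<le> C0 * (real N * ?A + ?B + ?O) + (D1 * (real N * ?A + ?B + ?O) + D2 * (real N * ?A + ?B + ?O))"
    proof -
      have "?O \<le> real N * ?A + ?B + ?O" "real N * ?A + ?B \<le> real N * ?A + ?B + ?O" "?A + ?B \<le> real N * ?A + ?B + ?O"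
        using NA AB by linarith+
      then show ?thesis
        using D C0 by (intro add_mono[of "C0 * _"] add_mono[of "D1 * _"] mult_left_mono) (simp_all only: less_imp_le)
    qed
    also have "\<dots> = (D1 + D2 + C0) * (real N * ?A + ?B + ?O)"
      by (simp only: distrib_right add_ac)
    finally show "(\<Sum>y\<in>herm_roots mu n. ?f y) \<le> (D1 + D2 + C0) * (real N * ?A + ?B + ?O)" .
  qed
qed

section \<open>Projection and interpolation\<close>

text \<open>Written in the variable \<open>beta * x\<close>, the functions of the space are
  dilations of those for \<open>beta = 1\<close>, and their inner products reduce to
  \<open>hint\<close> up to one power of \<open>beta\<close>.\<close>

definition hfun :: "real \<Rightarrow> real poly \<Rightarrow> real \<Rightarrow> real" where
  "hfun beta r x = exp (- ((beta * x)\<^sup>2) / 2) * poly r (beta * x)"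

lemma hfun_measurable [measurable]: "hfun beta r \<in> borel_measurable borel"
  unfolding hfun_def by measurable

lemma hfun_add: "hfun beta (r + s) x = hfun beta r x + hfun beta s x"
  and hfun_diff: "hfun beta (r - s) x = hfun beta r x - hfun beta s x"
  and hfun_smult: "hfun beta (smult a r) x = a * hfun beta r x"
  by (simp_all add: hfun_def algebra_simps)

lemma hfun_mult: "hfun beta r x * hfun beta s x = poly (r * s) (beta * x) * exp (- (beta * x)\<^sup>2)"
proof -
  have "exp (- (beta * x)\<^sup>2) = exp (- ((beta * x)\<^sup>2) / 2) * exp (- ((beta * x)\<^sup>2) / 2)"
    by (simp flip: exp_add)
  then show ?thesis by (simp add: hfun_def)
qed

lemma hfun_has_derivative:
  "(hfun beta r has_real_derivative hfun beta (smult beta (pderiv r - [:0, 1:] * r)) x) (at x)"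
  unfolding hfun_def by (auto intro!: derivative_eq_intros simp: algebra_simps power2_eq_square)

lemma hspace_eq:
  assumes "beta > 0"
  shows "hspace beta K = {hfun beta r | r. degree r \<le> K}"
proof -
  have "\<exists>r. degree r \<le> K \<and> (\<lambda>x. exp (- (beta\<^sup>2 * x\<^sup>2) / 2) * poly p x) = hfun beta r" if "degree p \<le> K" for p
    using that assms
    by (intro exI[of _ "pcompose p [:0, 1 / beta:]"])
       (auto simp: hfun_def poly_pcompose power_mult_distrib degree_pcompose)
  moreover have "\<exists>p. degree p \<le> K \<and> hfun beta r = (\<lambda>x. exp (- (beta\<^sup>2 * x\<^sup>2) / 2) * poly p x)" if "degree r \<le> K" for r
    using that assms
    by (intro exI[of _ "pcompose r [:0, beta:]"])
       (auto simp: hfun_def poly_pcompose power_mult_distrib degree_pcompose mult.commute)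
  ultimately show ?thesis
    unfolding hspace_def by blast
qed

lemma integral_scale:
  assumes "beta > 0"
  shows "(LINT x|lborel. f (beta * x) * hweight mu x)
    = beta powr (- 2 * mu - 1) * (LINT x|lborel. f x * hweight mu x)"
proof -
  have "(LINT x|lborel. f x * hweight mu x) = beta * (LINT x|lborel. f (beta * x) * hweight mu (beta * x))"
    using assms lborel_integral_real_affine[of beta "\<lambda>x. f x * hweight mu x" 0] by simp
  also have "(\<lambda>x. f (beta * x) * hweight mu (beta * x)) = (\<lambda>x. beta powr (2 * mu) * (f (beta * x) * hweight mu x))"
    using assms by (auto simp: hweight_def abs_mult powr_mult)
  also have "beta * (LINT x|lborel. beta powr (2 * mu) * (f (beta * x) * hweight mu x))
      = beta * (beta powr (2 * mu) * (LINT x|lborel. f (beta * x) * hweight mu x))"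
    by (simp only: integral_mult_right_zero)
  finally have "(LINT x|lborel. f x * hweight mu x) = (beta powr (2 * mu) * beta) * (LINT x|lborel. f (beta * x) * hweight mu x)"
    by simp
  also have "beta powr (2 * mu) * beta = beta powr (2 * mu + 1)"
    using assms by (simp add: powr_add)
  finally have "beta powr (- 2 * mu - 1) * (LINT x|lborel. f x * hweight mu x)
      = (beta powr (- 2 * mu - 1) * beta powr (2 * mu + 1)) * (LINT x|lborel. f (beta * x) * hweight mu x)"
    by simp
  also have "beta powr (- 2 * mu - 1) * beta powr (2 * mu + 1) = 1"
    using assms by (simp flip: powr_add)
  finally show ?thesis by simp
qed

lemma integrable_scale:
  assumes "beta > 0" "integrable lborel (\<lambda>x. f x * hweight mu x)"
  shows "integrable lborel (\<lambda>x. f (beta * x) * hweight mu x)"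
proof -
  have "integrable lborel (\<lambda>x. f (0 + beta * x) * hweight mu (0 + beta * x))"
    using assms by (intro lborel_integrable_real_affine[where f = "\<lambda>x. f x * hweight mu x"]) auto
  then have "integrable lborel (\<lambda>x. beta powr (- 2 * mu) * (f (beta * x) * hweight mu (beta * x)))"
    by simp
  moreover have "(\<lambda>x. beta powr (- 2 * mu) * (f (beta * x) * hweight mu (beta * x))) = (\<lambda>x. f (beta * x) * hweight mu x)"
    using assms(1) by (auto simp: hweight_def abs_mult powr_mult powr_minus)
  ultimately show ?thesis by (simp only:)
qed

lemma integral_hfun_mult:
  assumes "beta > 0"
  shows "(LINT x|lborel. hfun beta r x * hfun beta s x * hweight mu x) = beta powr (- 2 * mu - 1) * hint mu (r * s)"
proof -
  have "hint mu (r * s) = (LINT x|lborel. (poly (r * s) x * exp (- x\<^sup>2)) * hweight mu x)"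
    unfolding hint_def by (simp only: mult_ac)
  then show ?thesis
    unfolding hfun_mult integral_scale[OF assms, of "\<lambda>x. poly (r * s) x * exp (- x\<^sup>2)"] by simp
qed

lemma integrable_hfun_mult:
  assumes "mu \<ge> 0" "beta > 0"
  shows "integrable lborel (\<lambda>x. hfun beta r x * hfun beta s x * hweight mu x)"
proof -
  have "integrable lborel (\<lambda>x. (poly (r * s) x * exp (- x\<^sup>2)) * hweight mu x)"
    using integrable_poly_hweight[OF assms(1), of "r * s"] by (simp only: mult_ac)
  then show ?thesis
    unfolding hfun_mult by (rule integrable_scale[OF assms(2)])
qed

lemma in_L2w_hfun:
  assumes "mu \<ge> 0" "beta > 0"
  shows "in_L2w mu (hfun beta r)"
  using integrable_hfun_mult[OF assms, of r r] by (simp add: in_L2w_def power2_eq_square)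

lemma in_L2w_integrable_mult:
  assumes "in_L2w mu f" "in_L2w mu g"
  shows "integrable lborel (\<lambda>x. f x * g x * hweight mu x)"
proof (rule Bochner_Integration.integrable_bound)
  have [measurable]: "f \<in> borel_measurable borel" "g \<in> borel_measurable borel"
    using assms by (auto simp: in_L2w_def)
  show "integrable lborel (\<lambda>x. (f x)\<^sup>2 * hweight mu x + (g x)\<^sup>2 * hweight mu x)"
    using assms by (auto simp: in_L2w_def)
  show "AE x in lborel. norm (f x * g x * hweight mu x) \<le> norm ((f x)\<^sup>2 * hweight mu x + (g x)\<^sup>2 * hweight mu x)"
  proof (rule AE_I2)
    fix x
    have "0 \<le> (\<bar>f x\<bar> - \<bar>g x\<bar>)\<^sup>2" by simp
    then have "2 * (\<bar>f x\<bar> * \<bar>g x\<bar>) \<le> (f x)\<^sup>2 + (g x)\<^sup>2"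
      by (simp add: power2_diff)
    moreover have "0 \<le> \<bar>f x\<bar> * \<bar>g x\<bar>"
      by simp
    ultimately have "\<bar>f x\<bar> * \<bar>g x\<bar> \<le> (f x)\<^sup>2 + (g x)\<^sup>2"
      by linarith
    then have "\<bar>f x\<bar> * \<bar>g x\<bar> * hweight mu x \<le> ((f x)\<^sup>2 + (g x)\<^sup>2) * hweight mu x"
      by (rule mult_right_mono) simp
    then show "norm (f x * g x * hweight mu x) \<le> norm ((f x)\<^sup>2 * hweight mu x + (g x)\<^sup>2 * hweight mu x)"
      by (simp add: abs_mult distrib_right)
  qed
  show "(\<lambda>x. f x * g x * hweight mu x) \<in> borel_measurable lborel"
    by measurable
qed

lemma in_L2w_diff:
  assumes "in_L2w mu f" "in_L2w mu g"
  shows "in_L2w mu (\<lambda>x. f x - g x)"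
proof -
  have [measurable]: "f \<in> borel_measurable borel" "g \<in> borel_measurable borel"
    using assms by (auto simp: in_L2w_def)
  have "integrable lborel (\<lambda>x. (f x)\<^sup>2 * hweight mu x - 2 * (f x * g x * hweight mu x) + (g x)\<^sup>2 * hweight mu x)"
    using in_L2w_integrable_mult[OF assms] assms
    by (intro Bochner_Integration.integrable_add Bochner_Integration.integrable_diff integrable_mult_right)
       (auto simp: in_L2w_def)
  then show ?thesis
    by (simp add: in_L2w_def power2_eq_square algebra_simps)
qed

text \<open>Membership in the space is what interpolation can exploit, since it reproduces such
  functions. The value described by \<open>THE\<close> exists by the expansion in Hermite
  polynomials and is unique by positivity of \<open>hint\<close> on squares.\<close>

lemma hproj_in_hspace:
  assumes mu: "mu \<ge> 0" and beta: "beta > 0" and u: "in_L2w mu u"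
  obtains r where "degree r \<le> K" "hproj mu beta K u = hfun beta r"
proof -
  define k where "k = beta powr (- 2 * mu - 1)"
  have k: "k > 0" using beta by (simp add: k_def)
  define U where "U s = (LINT x|lborel. u x * hfun beta s x * hweight mu x)" for s
  have intU: "integrable lborel (\<lambda>x. u x * hfun beta s x * hweight mu x)" for s
    by (intro in_L2w_integrable_mult u in_L2w_hfun mu beta)
  have U_add: "U (s + t) = U s + U t" for s t
    using intU[of s] intU[of t] by (simp add: U_def hfun_add algebra_simps)
  have U_smult: "U (smult a s) = a * U s" for a s
  proof -
    have "(\<lambda>x. u x * hfun beta (smult a s) x * hweight mu x) = (\<lambda>x. a * (u x * hfun beta s x * hweight mu x))"
      by (simp add: hfun_smult mult_ac)
    then show ?thesis by (simp add: U_def)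
  qed
  have diff: "(LINT x|lborel. (u x - hfun beta r x) * hfun beta s x * hweight mu x) = U s - k * hint mu (r * s)" for r s
    unfolding U_def k_def integral_hfun_mult[OF beta, symmetric]
    using intU[of s] integrable_hfun_mult[OF mu beta, of r s]
    by (simp add: left_diff_distrib)
  \<comment> \<open>Fourier coefficients: \<open>k * hint\<close> of the square of
    \<open>herm mu j\<close> is the squared norm of its dilated Hermite function.\<close>
  define r where "r = (\<Sum>j\<le>K. smult (U (herm mu j) / (k * hint mu (herm mu j * herm mu j))) (herm mu j))"
  have deg: "degree r \<le> K"
    unfolding r_def by (intro degree_sum_le) (auto intro!: order.trans[OF degree_smult_le])
  have orth: "U s - k * hint mu (r * s) = 0" if "degree s \<le> K" for s
  proof -
    have ortho: "hint mu (herm mu i * herm mu j) = 0" if "i \<noteq> j" for i j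
      using herm_orthogonal[OF mu, of "herm mu i" j] herm_orthogonal[OF mu, of "herm mu j" i]
      by (cases i j rule: linorder_cases) (use that in \<open>auto simp: mult.commute[of "herm mu i"]\<close>)
    have base: "U (herm mu j) - k * hint mu (r * herm mu j) = 0" if "j \<le> K" for j
    proof -
      have "hint mu (r * herm mu j) = (\<Sum>i\<le>K. U (herm mu i) / (k * hint mu (herm mu i * herm mu i)) * hint mu (herm mu i * herm mu j))"
        unfolding r_def sum_distrib_right hint_sum[OF mu] mult_smult_left hint_smult ..
      also have "\<dots> = (\<Sum>i\<le>K. if i = j then U (herm mu j) / k else 0)"
        using hint_square_pos[OF mu herm_nonzero, of mu j] by (intro sum.cong) (auto simp: ortho)
      also have "\<dots> = U (herm mu j) / k"
        using that by simp
      finally show ?thesis using k by simp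
    qed
    \<comment> \<open>Orthogonality to each Hermite polynomial extends to all of degree at most
      \<open>K\<close> by splitting off the leading term.\<close>
    have "degree s \<le> j \<Longrightarrow> j \<le> K \<Longrightarrow> U s - k * hint mu (r * s) = 0" for j
    proof (induction j arbitrary: s)
      case 0
      then obtain a where "s = [:a:]" by (auto elim: degree_eq_zeroE)
      then have s: "s = smult a (herm mu 0)" by simp
      show ?case
        unfolding s using base[of 0] by (simp add: U_smult del: herm.simps)
    next
      case (Suc j)
      obtain a t where t: "s = smult a (herm mu (Suc j)) + t" "degree t < Suc j \<or> t = 0"
        by (rule degree_less_decompose[of s "Suc j" "herm mu (Suc j)"]) (use Suc.prems lead_coeff_herm in auto)
      have "U t - k * hint mu (r * t) = 0"
        using Suc.IH[of t] t(2) Suc.prems by auto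
      moreover have "U (herm mu (Suc j)) - k * hint mu (r * herm mu (Suc j)) = 0"
        using base Suc.prems by blast
      ultimately show ?case
        unfolding t(1) U_add U_smult distrib_left mult_smult_right hint_add[OF mu] hint_smult
        by (simp add: algebra_simps)
    qed
    then show ?thesis using that by blast
  qed
  have ex: "hfun beta r \<in> hspace beta K \<and>
    (\<forall>q\<in>hspace beta K. (LINT x|lborel. (u x - hfun beta r x) * q x * hweight mu x) = 0)"
    unfolding hspace_eq[OF beta] using deg orth diff by auto
  have "hproj mu beta K u = hfun beta r"
    unfolding hproj_def
  proof (rule the_equality, rule ex)
    fix v assume v: "v \<in> hspace beta K \<and> (\<forall>q\<in>hspace beta K. (LINT x|lborel. (u x - v x) * q x * hweight mu x) = 0)"
    then obtain s where s: "v = hfun beta s" "degree s \<le> K"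
      unfolding hspace_eq[OF beta] by auto
    have "degree (r - s) \<le> K"
      using deg s by (intro degree_diff_le)
    then have "U (r - s) - k * hint mu (r * (r - s)) = 0" "U (r - s) - k * hint mu (s * (r - s)) = 0"
      using orth v unfolding hspace_eq[OF beta] s(1) diff[symmetric] by auto
    then have "hint mu (r * (r - s)) = hint mu (s * (r - s))"
      using k by simp
    then have "hint mu ((r - s) * (r - s)) = 0"
      unfolding left_diff_distrib[of r s "r - s"] hint_diff[OF mu] by simp
    then have "r = s"
      using hint_square_pos[OF mu, of "r - s"] by auto
    then show "v = hfun beta r" by (simp add: s)
  qed
  then show thesis using that deg by blast
qed

text \<open>In the variable \<open>y = beta * x\<close> the nodes are the Hermite zeros; dividing
  the Gaussian out of the data leaves polynomial interpolation with \<open>K + 1\<close>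
  nodes.\<close>

lemma hinterp_eq:
  assumes mu: "mu \<ge> 0" and beta: "beta > 0"
  shows "hinterp mu beta K u = hfun beta (interp mu (Suc K) (\<lambda>y. exp (y\<^sup>2 / 2) * u (y / beta)))"
    (is "_ = hfun beta ?p")
  unfolding hinterp_def
proof (rule the_equality)
  have nodes: "hnodes mu beta K = {x. beta * x \<in> herm_roots mu (Suc K)}"
    by (simp add: hnodes_def gen_hermite_monic_eq_herm[OF mu] herm_roots_def)
  have deg: "degree ?p \<le> K"
    using degree_interp[OF mu, of "Suc K"] by simp
  have vals: "hfun beta ?p x = u x" if "beta * x \<in> herm_roots mu (Suc K)" for x
    using beta by (simp add: hfun_def poly_interp[OF that] exp_minus)
  show "hfun beta ?p \<in> hspace beta K \<and> (\<forall>x\<in>hnodes mu beta K. hfun beta ?p x = u x)"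
    unfolding hspace_eq[OF beta] nodes using deg vals by auto
  fix v assume v: "v \<in> hspace beta K \<and> (\<forall>x\<in>hnodes mu beta K. v x = u x)"
  then obtain s where s: "v = hfun beta s" "degree s \<le> K"
    unfolding hspace_eq[OF beta] by auto
  have "s = ?p"
  proof (rule poly_eqI_herm_roots[OF mu])
    fix y assume y: "y \<in> herm_roots mu (Suc K)"
    then have y': "beta * (y / beta) \<in> herm_roots mu (Suc K)"
      using beta by simp
    then have "y / beta \<in> hnodes mu beta K"
      by (simp only: nodes mem_Collect_eq)
    then have "hfun beta s (y / beta) = hfun beta ?p (y / beta)"
      using v vals[OF y'] s(1) by auto
    then show "poly s y = poly ?p y"
      using beta by (simp add: hfun_def)
  qed (use s deg in auto)
  then show "v = hfun beta ?p" by (simp add: s)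
qed

section \<open>The error estimate\<close>

lemma wnorm_square: "(wnorm mu f)\<^sup>2 = (LINT x|lborel. (f x)\<^sup>2 * hweight mu x)"
  by (simp add: wnorm_def integral_nonneg_AE)

lemma wnorm_nonneg: "wnorm mu f \<ge> 0"
  by (simp add: wnorm_def integral_nonneg_AE)

lemma interpolation_stability:
  assumes mu: "mu \<ge> 0"
  obtains C where "C > 0" "\<And>beta N n u u'. beta > 0 \<Longrightarrow> N \<ge> 1 \<Longrightarrow> n = 2 * N \<or> n = 2 * N + 1 \<Longrightarrow>
    continuous_on UNIV u \<Longrightarrow> \<forall>a b. a \<le> b \<longrightarrow> (u' has_integral (u b - u a)) {a..b} \<Longrightarrow>
    in_L2w mu u \<Longrightarrow> in_L2w mu u' \<Longrightarrow>
    wnorm mu (\<lambda>x. u x - hinterp mu beta n u x)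
      \<le> C * (sqrt (real N) * wnorm mu (\<lambda>x. u x - hproj mu beta n u x)
           + (1 / beta) * wnorm mu (\<lambda>x. u' x - deriv (hproj mu beta n u) x)
           + (if even n then (beta * sqrt (real N)) powr (- mu - 1/2) * \<bar>u 0 - hproj mu beta n u 0\<bar> else 0))"
proof -
  obtain C where C: "C > 0" and main: "\<And>N n w w'. N \<ge> 1 \<Longrightarrow> n = 2 * N + 1 \<or> n = 2 * N + 2 \<Longrightarrow> continuous_on UNIV w \<Longrightarrow>
    \<forall>s t. s \<le> t \<longrightarrow> (w' has_integral (w t - w s)) {s..t} \<Longrightarrow> in_L2w mu w \<Longrightarrow> in_L2w mu w' \<Longrightarrow>
    (\<Sum>y\<in>herm_roots mu n. gauss_weight mu n y * exp (y\<^sup>2) * (w y)\<^sup>2)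
      \<le> C * (real N * (LINT x|lborel. (w x)\<^sup>2 * hweight mu x) + (LINT x|lborel. (w' x)\<^sup>2 * hweight mu x)
        + (if odd n then real N powr (- mu - 1/2) * (w 0)\<^sup>2 else 0))"
    using nodes_sum_le[OF mu] by blast
  show thesis
  \<comment> \<open>The error is \<open>w\<close> minus its interpolant:
    \<open>(s - t)^2 \<le> 2 s^2 + 2 t^2\<close> gives 2 for \<open>w\<close> and \<open>2 C\<close>
    for the interpolant.\<close>
  proof (rule that[of "sqrt (2 + 2 * C)"])
    show "sqrt (2 + 2 * C) > 0" using C by simp
    fix beta :: real and N n :: nat and u u' :: "real \<Rightarrow> real"
    assume beta: "beta > 0" and N: "N \<ge> 1" and nN: "n = 2 * N \<or> n = 2 * N + 1"
      and cont: "continuous_on UNIV u" and u': "\<forall>a b. a \<le> b \<longrightarrow> (u' has_integral (u b - u a)) {a..b}"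
      and L2: "in_L2w mu u" "in_L2w mu u'"
    obtain r where r: "degree r \<le> n" "hproj mu beta n u = hfun beta r"
      using hproj_in_hspace[OF mu beta L2(1)] by blast
    define r' where "r' = smult beta (pderiv r - [:0, 1:] * r)"
    have deriv: "deriv (hfun beta r) = hfun beta r'"
      unfolding r'_def by (intro ext DERIV_imp_deriv hfun_has_derivative)
    define w where "w x = u x - hfun beta r x" for x
    define w' where "w' x = u' x - hfun beta r' x" for x
    have L2w: "in_L2w mu w" "in_L2w mu w'"
      unfolding w_def w'_def by (intro in_L2w_diff L2 in_L2w_hfun mu beta)+
    have cont_h: "continuous_on UNIV (hfun beta r)"
      unfolding hfun_def by (intro continuous_intros) auto
    have cont_w: "continuous_on UNIV w"
      unfolding w_def by (intro continuous_intros cont cont_h)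
    have w': "(w' has_integral (w t - w s)) {s..t}" if "s \<le> t" for s t
    proof -
      have "(hfun beta r' has_integral (hfun beta r t - hfun beta r s)) {s..t}"
        using hfun_has_derivative[of beta r, folded r'_def] that
        by (intro fundamental_theorem_of_calculus)
           (auto simp: has_real_derivative_iff_has_vector_derivative intro: has_vector_derivative_at_within)
      from has_integral_diff[OF u'[rule_format, OF that] this] show ?thesis
        by (simp add: w_def w'_def[abs_def] algebra_simps)
    qed
    define A where "A = (LINT x|lborel. (w x)\<^sup>2 * hweight mu x)"
    define B where "B = (LINT x|lborel. (w' x)\<^sup>2 * hweight mu x)"
    define k where "k = beta powr (- 2 * mu - 1)"
    have k: "k > 0" using beta by (simp add: k_def)
    have AB: "A \<ge> 0" "B \<ge> 0"
      by (auto simp: A_def B_def intro!: integral_nonneg_AE)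
    \<comment> \<open>Dilation to \<open>beta = 1\<close>. The derivative acquires the factor
      \<open>1 / beta\<close>, the source of \<open>beta^(-1)\<close> in the claim.\<close>
    define v where "v x = w (x / beta)" for x
    define v' where "v' x = w' (x / beta) / beta" for x
    have vA: "k * (LINT x|lborel. (v x)\<^sup>2 * hweight mu x) = A"
      using integral_scale[OF beta, of "\<lambda>x. (v x)\<^sup>2" mu] beta by (simp add: k_def A_def v_def)
    have vB: "k * (LINT x|lborel. (v' x)\<^sup>2 * hweight mu x) = B / beta\<^sup>2"
      using integral_scale[OF beta, of "\<lambda>x. (v' x)\<^sup>2" mu] beta by (simp add: k_def B_def v'_def power_divide)
    have meas [measurable]: "w \<in> borel_measurable borel" "w' \<in> borel_measurable borel"
      using L2w by (simp_all add: in_L2w_def)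
    have L2v: "in_L2w mu v" "in_L2w mu v'"
    proof -
      have "integrable lborel (\<lambda>x. (w (1 / beta * x))\<^sup>2 * hweight mu x)"
        using beta L2w by (intro integrable_scale) (auto simp: in_L2w_def)
      then show "in_L2w mu v"
        by (simp add: in_L2w_def v_def[abs_def])
      have "integrable lborel (\<lambda>x. (w' (1 / beta * x))\<^sup>2 * hweight mu x)"
        using beta L2w by (intro integrable_scale) (auto simp: in_L2w_def)
      then show "in_L2w mu v'"
        by (simp add: in_L2w_def v'_def[abs_def] power_divide)
    qed
    have v': "(v' has_integral (v t - v s)) {s..t}" if "s \<le> t" for s t
    proof -
      have "((\<lambda>x. w' (1 / beta * x)) has_integral (1 / \<bar>1 / beta\<bar>) *\<^sub>R (w (t / beta) - w (s / beta)))
          ((\<lambda>x. x / (1 / beta)) ` {s / beta..t / beta})"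
        using beta that by (intro has_integral_stretch_real[OF w']) (auto simp: divide_right_mono)
      also have "(\<lambda>x. x / (1 / beta)) ` {s / beta..t / beta} = {s..t}"
        using beta by (auto simp: image_iff field_simps intro!: bexI[of _ "_ / beta"])
      finally have "((\<lambda>x. w' (1 / beta * x) * (1 / beta)) has_integral
          ((1 / \<bar>1 / beta\<bar>) *\<^sub>R (w (t / beta) - w (s / beta)) * (1 / beta))) {s..t}"
        by (rule has_integral_mult_left)
      then show ?thesis
        using beta by (simp add: v_def[abs_def] v'_def[abs_def])
    qed
    have cont_v: "continuous_on UNIV v"
      unfolding v_def using beta by (intro continuous_on_compose2[OF cont_w] continuous_intros) auto
    \<comment> \<open>The polynomial of the interpolant of \<open>w\<close>: subtracting
      \<open>r\<close> uses that the projection is its own interpolant.\<close>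
    define q where "q = interp mu (Suc n) (\<lambda>y. exp (y\<^sup>2 / 2) * u (y / beta)) - r"
    have deg_q: "degree q \<le> n"
      unfolding q_def using degree_interp[OF mu, of "Suc n"] r(1) by (intro degree_diff_le) auto
    have poly_q: "poly q y = exp (y\<^sup>2 / 2) * v y" if "y \<in> herm_roots mu (Suc n)" for y
      using beta by (simp add: q_def poly_interp[OF that] v_def w_def hfun_def right_diff_distrib exp_minus)
    \<comment> \<open>The degree \<open>2 n\<close> lies below the limit
      \<open>2 (n + 1) - 1\<close> of exactness for \<open>n + 1\<close> nodes.\<close>
    have "hint mu (q * q) = quad mu (Suc n) (q * q)"
      using deg_q by (intro quad_exact[OF mu, symmetric] order.trans[OF degree_mult_le]) auto
    also have "\<dots> = (\<Sum>y\<in>herm_roots mu (Suc n). gauss_weight mu (Suc n) y * exp (y\<^sup>2) * (v y)\<^sup>2)"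
      unfolding quad_def
    proof (intro sum.cong refl)
      fix y assume y: "y \<in> herm_roots mu (Suc n)"
      have "exp (y\<^sup>2) = exp (y\<^sup>2 / 2) * exp (y\<^sup>2 / 2)"
        by (simp flip: exp_add)
      then show "gauss_weight mu (Suc n) y * poly (q * q) y = gauss_weight mu (Suc n) y * exp (y\<^sup>2) * (v y)\<^sup>2"
        by (simp add: poly_q[OF y] power2_eq_square)
    qed
    also have "\<dots> \<le> C * (real N * (LINT x|lborel. (v x)\<^sup>2 * hweight mu x) + (LINT x|lborel. (v' x)\<^sup>2 * hweight mu x)
        + (if odd (Suc n) then real N powr (- mu - 1/2) * (v 0)\<^sup>2 else 0))"
      using nN v' by (intro main N cont_v L2v) auto
    finally have "k * hint mu (q * q) \<le> k * (C * (real N * (LINT x|lborel. (v x)\<^sup>2 * hweight mu x) + (LINT x|lborel. (v' x)\<^sup>2 * hweight mu x)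
        + (if odd (Suc n) then real N powr (- mu - 1/2) * (v 0)\<^sup>2 else 0)))"
      using k by (intro mult_left_mono) auto
    also have "\<dots> = C * (real N * (k * (LINT x|lborel. (v x)\<^sup>2 * hweight mu x)) + (k * (LINT x|lborel. (v' x)\<^sup>2 * hweight mu x))
        + (if even n then k * real N powr (- mu - 1/2) * (w 0)\<^sup>2 else 0))"
      by (simp add: v_def algebra_simps)
    \<comment> \<open>The dilation factor \<open>k\<close> and the decay of the Christoffel number
      at 0 combine into the square of the coefficient of \<open>|w(0)|\<close>.\<close>
    also have "k * real N powr (- mu - 1/2) = ((beta * sqrt (real N)) powr (- mu - 1/2))\<^sup>2"
    proof -
      have "((beta * sqrt (real N)) powr (- mu - 1/2))\<^sup>2 = ((beta * sqrt (real N))\<^sup>2) powr (- mu - 1/2)"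
        using beta by (simp add: powr_power powr_powr mult.commute[of mu 2] flip: powr_numeral)
      also have "\<dots> = (beta\<^sup>2) powr (- mu - 1/2) * real N powr (- mu - 1/2)"
        by (simp add: power_mult_distrib powr_mult)
      also have "(beta\<^sup>2) powr (- mu - 1/2) = k"
        using beta by (simp add: k_def powr_powr flip: powr_numeral)
      finally show ?thesis by simp
    qed
    finally have hq: "k * hint mu (q * q) \<le> C * (real N * A + B / beta\<^sup>2
        + (if even n then ((beta * sqrt (real N)) powr (- mu - 1/2))\<^sup>2 * (w 0)\<^sup>2 else 0))"
      unfolding vA vB .
    define a where "a = sqrt (real N) * wnorm mu w"
    define b where "b = (1 / beta) * wnorm mu w'"
    define c where "c = (if even n then (beta * sqrt (real N)) powr (- mu - 1/2) * \<bar>w 0\<bar> else 0)"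
    have abc: "a \<ge> 0" "b \<ge> 0" "c \<ge> 0"
      using beta by (auto simp: a_def b_def c_def wnorm_nonneg)
    have a2: "a\<^sup>2 = real N * A" and b2: "b\<^sup>2 = B / beta\<^sup>2"
      by (simp_all add: a_def b_def power_mult_distrib power_divide wnorm_square A_def B_def)
    have c2: "c\<^sup>2 = (if even n then ((beta * sqrt (real N)) powr (- mu - 1/2))\<^sup>2 * (w 0)\<^sup>2 else 0)"
      by (simp add: c_def power_mult_distrib)
    have hq': "k * hint mu (q * q) \<le> C * (a\<^sup>2 + b\<^sup>2 + c\<^sup>2)"
      using hq unfolding a2 b2 c2 .
    have "1 * A \<le> real N * A"
      using N AB by (intro mult_right_mono) auto
    then have Aa: "A \<le> a\<^sup>2 + b\<^sup>2 + c\<^sup>2"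
    unfolding a2[symmetric] mult_1 by (simp add: add_increasing2)
    have err: "u x - hinterp mu beta n u x = w x - hfun beta q x" for x
      by (simp add: hinterp_eq[OF mu beta] w_def q_def hfun_diff)
    have "(LINT x|lborel. (w x - hfun beta q x)\<^sup>2 * hweight mu x)
        \<le> (LINT x|lborel. 2 * ((w x)\<^sup>2 * hweight mu x) + 2 * (hfun beta q x * hfun beta q x * hweight mu x))"
    proof (rule integral_mono)
      show "integrable lborel (\<lambda>x. (w x - hfun beta q x)\<^sup>2 * hweight mu x)"
        using in_L2w_diff[OF L2w(1) in_L2w_hfun[OF mu beta]] by (simp add: in_L2w_def)
      show "integrable lborel (\<lambda>x. 2 * ((w x)\<^sup>2 * hweight mu x) + 2 * (hfun beta q x * hfun beta q x * hweight mu x))"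
        using L2w(1) integrable_hfun_mult[OF mu beta]
        by (intro Bochner_Integration.integrable_add integrable_mult_right) (auto simp: in_L2w_def)
      fix x
      have "0 \<le> (w x + hfun beta q x)\<^sup>2" by simp
      then have "(w x - hfun beta q x)\<^sup>2 \<le> 2 * (w x)\<^sup>2 + 2 * (hfun beta q x * hfun beta q x)"
        by (simp add: power2_eq_square algebra_simps)
      then have "(w x - hfun beta q x)\<^sup>2 * hweight mu x \<le> (2 * (w x)\<^sup>2 + 2 * (hfun beta q x * hfun beta q x)) * hweight mu x"
        by (rule mult_right_mono) simp
      then show "(w x - hfun beta q x)\<^sup>2 * hweight mu x
          \<le> 2 * ((w x)\<^sup>2 * hweight mu x) + 2 * (hfun beta q x * hfun beta q x * hweight mu x)"
        by (simp add: distrib_right mult.assoc)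
    qed
    also have "\<dots> = 2 * A + 2 * (k * hint mu (q * q))"
    proof -
      have "integrable lborel (\<lambda>x. 2 * ((w x)\<^sup>2 * hweight mu x))"
        "integrable lborel (\<lambda>x. 2 * (hfun beta q x * hfun beta q x * hweight mu x))"
        using L2w(1) integrable_hfun_mult[OF mu beta] by (auto simp: in_L2w_def)
      then show ?thesis
        by (simp add: A_def k_def integral_hfun_mult[OF beta])
    qed
    also have "\<dots> \<le> 2 * (a\<^sup>2 + b\<^sup>2 + c\<^sup>2) + 2 * (C * (a\<^sup>2 + b\<^sup>2 + c\<^sup>2))"
      using Aa hq' by (intro add_mono mult_left_mono) auto
    also have "\<dots> = (2 + 2 * C) * (a\<^sup>2 + b\<^sup>2 + c\<^sup>2)"
      by (simp add: algebra_simps)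
    \<comment> \<open>All cross terms are nonnegative, so the root can be taken of a single
      square.\<close>
    also have "\<dots> \<le> (2 + 2 * C) * (a + b + c)\<^sup>2"
      using C abc by (intro mult_left_mono) (auto simp: power2_eq_square algebra_simps)
    finally have "wnorm mu (\<lambda>x. w x - hfun beta q x) \<le> sqrt ((2 + 2 * C) * (a + b + c)\<^sup>2)"
      unfolding wnorm_def by (rule real_sqrt_le_mono)
    also have "\<dots> = sqrt (2 + 2 * C) * (a + b + c)"
      using abc by (simp add: real_sqrt_mult)
    finally show "wnorm mu (\<lambda>x. u x - hinterp mu beta n u x)
      \<le> sqrt (2 + 2 * C) * (sqrt (real N) * wnorm mu (\<lambda>x. u x - hproj mu beta n u x)
           + (1 / beta) * wnorm mu (\<lambda>x. u' x - deriv (hproj mu beta n u) x)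
           + (if even n then (beta * sqrt (real N)) powr (- mu - 1/2) * \<bar>u 0 - hproj mu beta n u 0\<bar> else 0))"
      unfolding err r(2) deriv a_def b_def c_def w_def w'_def .
  qed
qed

theorem mainTheorem8:
  fixes mu :: real
  assumes "mu \<ge> 0"
  shows "\<exists>C>0. \<forall>(beta::real) (N::nat) (u::real \<Rightarrow> real) (u'::real \<Rightarrow> real).
    beta > 0 \<and> N \<ge> 1 \<and> continuous_on UNIV u \<and>
    (\<forall>a b. a \<le> b \<longrightarrow> (u' has_integral (u b - u a)) {a..b}) \<and>
    in_L2w mu u \<and> in_L2w mu u' \<longrightarrow>
      wnorm mu (\<lambda>x. u x - hinterp mu beta (2*N) u x)
        \<le> C * (sqrt (real N) * wnorm mu (\<lambda>x. u x - hproj mu beta (2*N) u x)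
             + (1 / beta) * wnorm mu (\<lambda>x. u' x - deriv (hproj mu beta (2*N) u) x)
             + (beta * sqrt (real N)) powr (- mu - 1/2)
                 * \<bar>u 0 - hproj mu beta (2*N) u 0\<bar>)
    \<and> wnorm mu (\<lambda>x. u x - hinterp mu beta (2*N+1) u x)
        \<le> C * (sqrt (real N) * wnorm mu (\<lambda>x. u x - hproj mu beta (2*N+1) u x)
             + (1 / beta) * wnorm mu (\<lambda>x. u' x - deriv (hproj mu beta (2*N+1) u) x))"
proof -
  obtain C where C: "C > 0" and bound: "\<And>beta N n u u'. beta > 0 \<Longrightarrow> N \<ge> 1 \<Longrightarrow> n = 2 * N \<or> n = 2 * N + 1 \<Longrightarrow>
    continuous_on UNIV u \<Longrightarrow> \<forall>a b. a \<le> b \<longrightarrow> (u' has_integral (u b - u a)) {a..b} \<Longrightarrow>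
    in_L2w mu u \<Longrightarrow> in_L2w mu u' \<Longrightarrow>
    wnorm mu (\<lambda>x. u x - hinterp mu beta n u x)
      \<le> C * (sqrt (real N) * wnorm mu (\<lambda>x. u x - hproj mu beta n u x)
           + (1 / beta) * wnorm mu (\<lambda>x. u' x - deriv (hproj mu beta n u) x)
           + (if even n then (beta * sqrt (real N)) powr (- mu - 1/2) * \<bar>u 0 - hproj mu beta n u 0\<bar> else 0))"
    using interpolation_stability[OF assms] by blast
  show ?thesis
  proof (intro exI[of _ C] conjI allI impI C)
    fix beta :: real and N :: nat and u u' :: "real \<Rightarrow> real"
    assume "beta > 0 \<and> N \<ge> 1 \<and> continuous_on UNIV u \<and>
      (\<forall>a b. a \<le> b \<longrightarrow> (u' has_integral (u b - u a)) {a..b}) \<and> in_L2w mu u \<and> in_L2w mu u'"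
    then have hyps: "beta > 0" "N \<ge> 1" "continuous_on UNIV u"
      "\<forall>a b. a \<le> b \<longrightarrow> (u' has_integral (u b - u a)) {a..b}" "in_L2w mu u" "in_L2w mu u'"
      by auto
    show "wnorm mu (\<lambda>x. u x - hinterp mu beta (2*N) u x)
        \<le> C * (sqrt (real N) * wnorm mu (\<lambda>x. u x - hproj mu beta (2*N) u x)
             + (1 / beta) * wnorm mu (\<lambda>x. u' x - deriv (hproj mu beta (2*N) u) x)
             + (beta * sqrt (real N)) powr (- mu - 1/2)
                 * \<bar>u 0 - hproj mu beta (2*N) u 0\<bar>)"
      using bound[OF hyps(1,2) _ hyps(3-6), of "2 * N"] by simp
    show "wnorm mu (\<lambda>x. u x - hinterp mu beta (2*N+1) u x)
        \<le> C * (sqrt (real N) * wnorm mu (\<lambda>x. u x - hproj mu beta (2*N+1) u x)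
             + (1 / beta) * wnorm mu (\<lambda>x. u' x - deriv (hproj mu beta (2*N+1) u) x))"
      using bound[OF hyps(1,2) _ hyps(3-6), of "2 * N + 1"] by simp
  qed
qed

end
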